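(* Let $n\ge 2$, let $n_0$ be the product of the distinct prime divisors of $n$, let $k$ be the number of distinct prime divisors of $n$, and let $1=d_1<d_2<\dots<d_{2^k}=n_0$ be the divisors of $n_0$. Then the spectrum of the adjacency matrix $A(Q_n)$ of the generating graph $\Gamma(Q_n)$ of the dicyclic group $Q_n$ is $$\mathrm{Spec}_{A(Q_n)}=\begin{pmatrix}0&2\mu(d_2)\frac{\varphi(n)}{\varphi(d_2)}&2\mu(d_3)\frac{\varphi(n)}{\varphi(d_3)}&\dots&2\mu(d_{2^k})\frac{\varphi(n)}{\varphi(d_{2^k})}&\lambda_1&\lambda_2\\4n-(n_0+1)&\varphi(d_2)&\varphi(d_3)&\dots&\varphi(d_{2^k})&1&1\end{pmatrix},$$ where $\lambda_1=\varphi(n)+\sqrt{\varphi(n)^2+4n\varphi(n)}$ and $\lambda_2=\varphi(n)-\sqrt{\varphi(n)^2+4n\varphi(n)}$.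
   Context: For $n\ge 2$, the dicyclic group is $Q_n=\langle x,y : x^{2n}=1,\ x^n=y^2,\ yx=x^{-1}y\rangle$, of order $4n$. The generating graph $\Gamma(G)$ of a group $G$ is the simple undirected graph with vertex set $G$ in which two distinct vertices $g,h$ are adjacent iff $\langle g,h\rangle=G$. $\varphi$ is Euler's totient function and $\mu$ the Möbius function. In the two-row notation for a spectrum, the top row lists eigenvalues and the bottom row their multiplicities; the spectrum is a multiset (if the same number appears in several columns, the multiplicities add, and columns with multiplicity $0$ are void). *)

theory Defs
  imports
    Complex_Main
    "HOL-Algebra.Generated_Groups"
    "HOL-Number_Theory.Totient"
    "HOL-Computational_Algebra.Squarefree"
    "HOL-Computational_Algebra.Fundamental_Theorem_Algebra"
    "Graph_Theory.Pair_Digraph"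
    "Jordan_Normal_Form.Char_Poly"
begin

section \<open>Groups given by generators and relations\<close>

text \<open>
  A word is a list of signed generators: \<open>(a, True)\<close> stands for the generator \<open>a\<close> and
  \<open>(a, False)\<close> for its formal inverse. A relation \<open>l = r\<close> is the pair \<open>(l, r)\<close>.
  The group \<open>\<langle>'a | R\<rangle>\<close> consists of all words over \<open>'a\<close> modulo the congruence \<open>word_eq R\<close>,
  the least one that contains free cancellation and the relations in \<open>R\<close>.
\<close>

type_synonym 'a word = "('a \<times> bool) list"

inductive word_eq :: "('a word \<times> 'a word) set \<Rightarrow> 'a word \<Rightarrow> 'a word \<Rightarrow> bool"
  for R :: "('a word \<times> 'a word) set"
where
  refl: "word_eq R u u"
| sym: "word_eq R u v \<Longrightarrow> word_eq R v u"
| trans: "word_eq R u v \<Longrightarrow> word_eq R v w \<Longrightarrow> word_eq R u w"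
| cancel: "word_eq R (u @ [(a, s), (a, \<not> s)] @ v) (u @ v)"
| relation: "(l, r) \<in> R \<Longrightarrow> word_eq R (u @ l @ v) (u @ r @ v)"

definition word_class :: "('a word \<times> 'a word) set \<Rightarrow> 'a word \<Rightarrow> 'a word set" where
  "word_class R u = {v. word_eq R u v}"

definition presented_group :: "('a word \<times> 'a word) set \<Rightarrow> 'a word set monoid" where
  "presented_group R =
    \<lparr>carrier = range (word_class R),
     monoid.mult = (\<lambda>A B. \<Union>u\<in>A. \<Union>v\<in>B. word_class R (u @ v)),
     one = word_class R []\<rparr>"


section \<open>The dicyclic group\<close>

datatype dicyclic_gen = GX | GY

definition dicyclic_relations :: "nat \<Rightarrow> (dicyclic_gen word \<times> dicyclic_gen word) set" where
  "dicyclic_relations n =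
    {(replicate (2 * n) (GX, True), []),
     (replicate n (GX, True), [(GY, True), (GY, True)]),
     ([(GY, True), (GX, True)], [(GX, False), (GY, True)])}"

definition dicyclic_group :: "nat \<Rightarrow> dicyclic_gen word set monoid" where
  "dicyclic_group n = presented_group (dicyclic_relations n)"


section \<open>The generating graph and its spectrum\<close>

text \<open>As in \<^theory>\<open>Graph_Theory.Digraph\<close>, simple graphs are symmetric loop-free digraphs.\<close>

definition generating_graph :: "('a, 'b) monoid_scheme \<Rightarrow> 'a pair_pre_digraph" where
  "generating_graph G =
    \<lparr>pverts = carrier G,
     parcs = {(g, h). g \<in> carrier G \<and> h \<in> carrier G \<and> g \<noteq> h \<and>
                      generate G {g, h} = carrier G}\<rparr>"

definition adjacency_matrix :: "'a pair_pre_digraph \<Rightarrow> 'a list \<Rightarrow> complex mat" where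
  "adjacency_matrix \<Gamma> vs =
    mat (length vs) (length vs) (\<lambda>(i, j). if (vs ! i, vs ! j) \<in> parcs \<Gamma> then 1 else 0)"

text \<open>The multiset of complex eigenvalues, counted with algebraic multiplicity.\<close>

definition spectrum_mset :: "complex mat \<Rightarrow> complex multiset" where
  "spectrum_mset A = proots (char_poly A)"

definition moebius_mu :: "nat \<Rightarrow> int" where
  "moebius_mu m = (if squarefree m then (-1) ^ card (prime_factors m) else 0)"


section \<open>Well-definedness\<close>

lemma word_eq_class: "word_class R u = word_class R v \<longleftrightarrow> word_eq R u v"
proof
  assume "word_class R u = word_class R v"
  moreover have "v \<in> word_class R v" by (simp add: word_class_def word_eq.refl)
  ultimately show "word_eq R u v" by (simp add: word_class_def set_eq_iff)
next
  assume uv: "word_eq R u v"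
  show "word_class R u = word_class R v"
    unfolding word_class_def
    using word_eq.trans[OF uv] word_eq.trans[OF word_eq.sym[OF uv]] by blast
qed

lemma word_eq_append_left: "word_eq R u v \<Longrightarrow> word_eq R (w @ u) (w @ v)"
proof (induction rule: word_eq.induct)
  case (cancel u a s v)
  then show ?case using word_eq.cancel[of R "w @ u" a s v] by simp
next
  case (relation l r u v)
  then show ?case using word_eq.relation[of l r R "w @ u" v] by simp
qed (simp add: word_eq.refl, erule word_eq.sym, erule (1) word_eq.trans)

lemma word_eq_append_right: "word_eq R u v \<Longrightarrow> word_eq R (u @ w) (v @ w)"
proof (induction rule: word_eq.induct)
  case (cancel u a s v)
  then show ?case using word_eq.cancel[of R u a s "v @ w"] by simp
next
  case (relation l r u v)
  then show ?case using word_eq.relation[of l r R u "v @ w"] by simp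
qed (simp add: word_eq.refl, erule word_eq.sym, erule (1) word_eq.trans)

lemma word_eq_append:
  "word_eq R u u' \<Longrightarrow> word_eq R v v' \<Longrightarrow> word_eq R (u @ v) (u' @ v')"
  by (meson word_eq.trans word_eq_append_left word_eq_append_right)

lemma presented_group_mult:
  "word_class R u \<otimes>\<^bsub>presented_group R\<^esub> word_class R v = word_class R (u @ v)"
proof -
  have "word_class R (u' @ v') = word_class R (u @ v)"
    if "u' \<in> word_class R u" "v' \<in> word_class R v" for u' v'
    using that unfolding word_eq_class unfolding word_class_def
    by (blast intro: word_eq_append word_eq.sym)
  moreover have "u \<in> word_class R u" "v \<in> word_class R v"
    by (auto simp: word_class_def word_eq.refl)
  ultimately have "(\<Union>u'\<in>word_class R u. \<Union>v'\<in>word_class R v. word_class R (u' @ v'))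
      = word_class R (u @ v)"
    by blast
  then show ?thesis by (simp add: presented_group_def)
qed

lemma word_eq_inverse: "word_eq R (map (apsnd Not) (rev u) @ u) []"
proof (induction u)
  case Nil
  then show ?case by (simp add: word_eq.refl)
next
  case (Cons a u)
  obtain b s where a: "a = (b, s)" by (cases a)
  have "word_eq R (map (apsnd Not) (rev u) @ [(b, \<not> s), (b, \<not> \<not> s)] @ u)
          (map (apsnd Not) (rev u) @ u)"
    by (rule word_eq.cancel)
  from word_eq.trans[OF this Cons] show ?case by (simp add: a)
qed

lemma group_presented_group: "group (presented_group R)"
proof (rule groupI)
  fix A assume "A \<in> carrier (presented_group R)"
  then obtain u where A: "A = word_class R u" by (auto simp: presented_group_def)
  have one: "\<one>\<^bsub>presented_group R\<^esub> = word_class R []" by (simp add: presented_group_def)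
  show "\<one>\<^bsub>presented_group R\<^esub> \<otimes>\<^bsub>presented_group R\<^esub> A = A"
    by (simp add: one A presented_group_mult)
  show "\<exists>B\<in>carrier (presented_group R). B \<otimes>\<^bsub>presented_group R\<^esub> A = \<one>\<^bsub>presented_group R\<^esub>"
  proof
    show "word_class R (map (apsnd Not) (rev u)) \<in> carrier (presented_group R)"
      by (simp add: presented_group_def)
  qed (simp add: A one presented_group_mult word_eq_class word_eq_inverse)
next
  fix A B C
  assume "A \<in> carrier (presented_group R)" "B \<in> carrier (presented_group R)"
    "C \<in> carrier (presented_group R)"
  then obtain u v w where "A = word_class R u" "B = word_class R v" "C = word_class R w"
    by (auto simp: presented_group_def)
  then show "A \<otimes>\<^bsub>presented_group R\<^esub> B \<otimes>\<^bsub>presented_group R\<^esub> C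
      = A \<otimes>\<^bsub>presented_group R\<^esub> (B \<otimes>\<^bsub>presented_group R\<^esub> C)"
    by (simp add: presented_group_mult)
next
  fix A B
  assume "A \<in> carrier (presented_group R)" "B \<in> carrier (presented_group R)"
  then obtain u v where "A = word_class R u" "B = word_class R v"
    by (auto simp: presented_group_def)
  then show "A \<otimes>\<^bsub>presented_group R\<^esub> B \<in> carrier (presented_group R)"
    by (simp only: presented_group_mult) (simp add: presented_group_def)
qed (simp add: presented_group_def)

text \<open>
  The normal form \<open>x\<^sup>i y\<^sup>b\<close> with \<open>0 \<le> i < 2 n\<close>: the letters act on pairs \<open>(i, b)\<close> by
  left multiplication.
\<close>

fun dicyclic_act :: "nat \<Rightarrow> dicyclic_gen \<times> bool \<Rightarrow> int \<times> bool \<Rightarrow> int \<times> bool" where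
  "dicyclic_act n (GX, s) (i, b) = ((if s then i + 1 else i - 1) mod (2 * int n), b)"
| "dicyclic_act n (GY, s) (i, b) =
     ((if s = b then int n - i else - i) mod (2 * int n), \<not> b)"

definition dicyclic_nf :: "int \<times> bool \<Rightarrow> dicyclic_gen word" where
  "dicyclic_nf p =
    replicate (nat (fst p)) (GX, True) @ (if snd p then [(GY, True)] else [])"

lemma funpow_dicyclic_act_X:
  "0 < n \<Longrightarrow> i \<in> {0..<2 * int n} \<Longrightarrow>
    (dicyclic_act n (GX, True) ^^ k) (i, b) = ((i + int k) mod (2 * int n), b)"
  by (induction k) (auto simp: mod_simps algebra_simps)

lemma dicyclic_act_closed:
  "0 < n \<Longrightarrow> p \<in> {0..<2 * int n} \<times> UNIV \<Longrightarrow> dicyclic_act n a p \<in> {0..<2 * int n} \<times> UNIV"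
  by (cases a; cases "fst a"; cases p) auto

lemma foldr_dicyclic_act_closed:
  "0 < n \<Longrightarrow> p \<in> {0..<2 * int n} \<times> UNIV \<Longrightarrow>
    foldr (dicyclic_act n) u p \<in> {0..<2 * int n} \<times> UNIV"
  by (induction u) (simp_all add: dicyclic_act_closed del: mem_Times_iff)

lemma dicyclic_act_word_eq:
  assumes "0 < n" "word_eq (dicyclic_relations n) u v" "p \<in> {0..<2 * int n} \<times> UNIV"
  shows "foldr (dicyclic_act n) u p = foldr (dicyclic_act n) v p"
  using assms(2,3)
proof (induction arbitrary: p rule: word_eq.induct)
  case (cancel u a s v)
  obtain i b where q: "foldr (dicyclic_act n) v p = (i, b)" by (cases "foldr (dicyclic_act n) v p")
  with foldr_dicyclic_act_closed[OF assms(1) cancel, of v] have i: "0 \<le> i" "i < 2 * int n" by auto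
  have "dicyclic_act n (a, s) (dicyclic_act n (a, \<not> s) (i, b)) = (i, b)"
    using i by (cases a) (auto simp: mod_simps)
  with q show ?case by simp
next
  case (relation l r u v)
  obtain i b where q: "foldr (dicyclic_act n) v p = (i, b)" by (cases "foldr (dicyclic_act n) v p")
  with foldr_dicyclic_act_closed[OF assms(1) relation(2), of v]
  have i: "0 \<le> i" "i < 2 * int n" by auto
  have "foldr (dicyclic_act n) l (i, b) = foldr (dicyclic_act n) r (i, b)"
    using relation(1) i assms(1) mod_add_self2[of "i - int n" "2 * int n"]
    unfolding dicyclic_relations_def
    by (auto simp: funpow_dicyclic_act_X mod_simps algebra_simps minus_diff_commute)
  with q show ?case by simp
qed auto

lemma dicyclic_nf_inj:
  assumes "0 < n"
  shows "inj_on (\<lambda>p. word_class (dicyclic_relations n) (dicyclic_nf p))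
    ({0..<2 * int n} \<times> UNIV)"
proof (rule inj_on_inverseI)
  fix p :: "int \<times> bool" assume "p \<in> {0..<2 * int n} \<times> UNIV"
  then obtain i b where p: "p = (i, b)" "0 \<le> i" "i < 2 * int n" by auto
  define w where "w = (SOME w. w \<in> word_class (dicyclic_relations n) (dicyclic_nf p))"
  have "dicyclic_nf p \<in> word_class (dicyclic_relations n) (dicyclic_nf p)"
    by (simp add: word_class_def word_eq.refl)
  then have "w \<in> word_class (dicyclic_relations n) (dicyclic_nf p)"
    unfolding w_def by (rule someI)
  then have "word_eq (dicyclic_relations n) (dicyclic_nf p) w" by (simp add: word_class_def)
  from dicyclic_act_word_eq[OF assms this, of "(0, False)"] assms
  have "foldr (dicyclic_act n) w (0, False) = foldr (dicyclic_act n) (dicyclic_nf p) (0, False)"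
    by simp
  also have "\<dots> = p"
    using p assms by (auto simp: dicyclic_nf_def funpow_dicyclic_act_X)
  finally show "foldr (dicyclic_act n)
      (SOME w. w \<in> word_class (dicyclic_relations n) (dicyclic_nf p)) (0, False) = p"
    unfolding w_def .
qed

lemma dicyclic_nf_exists:
  assumes n: "0 < n"
  shows "\<exists>p\<in>{0..<2 * int n} \<times> UNIV. word_eq (dicyclic_relations n) u (dicyclic_nf p)"
proof -
  let ?R = "dicyclic_relations n" and ?S = "{0..<2 * int n} \<times> (UNIV :: bool set)"
  let ?x = "(GX, True)" and ?y = "(GY, True)" and ?x' = "(GX, False)" and ?y' = "(GY, False)"
  define T where "T = {u. \<exists>p\<in>?S. word_eq ?R u (dicyclic_nf p)}"
  have nfI: "dicyclic_nf p \<in> T" if "p \<in> ?S" for p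
    unfolding T_def using that word_eq.refl by blast
  have T_eq: "u \<in> T" if "word_eq ?R u v" "v \<in> T" for u v
    using that unfolding T_def by (blast intro: word_eq.trans)
  have T_cons: "a # u \<in> T" if "u \<in> T" "\<And>p. p \<in> ?S \<Longrightarrow> a # dicyclic_nf p \<in> T" for a u
  proof -
    from that(1) obtain p where p: "p \<in> ?S" "word_eq ?R u (dicyclic_nf p)" unfolding T_def by blast
    show ?thesis
      using T_eq[OF word_eq_append_left[OF p(2), of "[a]"]] that(2)[OF p(1)] by simp
  qed
  have rel1: "word_eq ?R (u @ replicate (2 * n) ?x @ v) (u @ v)" for u v
    using word_eq.relation[of "replicate (2 * n) ?x" "[]" ?R u v] by (simp add: dicyclic_relations_def)
  have rel2: "word_eq ?R (u @ [?y, ?y] @ v) (u @ replicate n ?x @ v)" for u v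
    by (rule word_eq.sym, rule word_eq.relation) (simp add: dicyclic_relations_def)
  have rel3: "word_eq ?R (u @ [?y, ?x] @ v) (u @ [?x', ?y] @ v)" for u v
    by (rule word_eq.relation) (simp add: dicyclic_relations_def)
  have X: "?x # u \<in> T" if "u \<in> T" for u
  proof (rule T_cons[OF that])
    fix p assume "p \<in> ?S"
    then obtain i b where p: "p = (i, b)" "0 \<le> i" "i < 2 * int n" by auto
    have cons: "?x # dicyclic_nf p = dicyclic_nf (i + 1, b)"
      using p by (simp add: dicyclic_nf_def nat_add_distrib)
    show "?x # dicyclic_nf p \<in> T"
    proof (cases "i + 1 < 2 * int n")
      case True
      then show ?thesis unfolding cons using p by (intro nfI) auto
    next
      case False
      with p have i: "nat (i + 1) = 2 * n" by auto
      have "word_eq ?R (dicyclic_nf (i + 1, b)) (dicyclic_nf (0, b))"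
        using rel1[of "[]" "if b then [?y] else []"] by (simp add: dicyclic_nf_def i)
      then show ?thesis unfolding cons by (rule T_eq) (rule nfI, use n in auto)
    qed
  qed
  have Xs: "replicate k ?x @ u \<in> T" if "u \<in> T" for k u
    by (induction k) (auto simp: that X)
  have X': "?x' # u \<in> T" if "u \<in> T" for u
  proof -
    obtain m where m: "2 * n = Suc m" using n by (cases "2 * n") auto
    have "word_eq ?R (?x' # u) ([?x'] @ replicate (2 * n) ?x @ u)"
      using word_eq.sym[OF rel1[of "[?x']" u]] by simp
    also have "word_eq ?R \<dots> (replicate m ?x @ u)"
      using word_eq.cancel[of ?R "[]" GX False "replicate m ?x @ u"] by (simp add: m)
    finally (word_eq.trans) show ?thesis using Xs[OF that] by (rule T_eq)
  qed
  have X's: "replicate k ?x' @ u \<in> T" if "u \<in> T" for k u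
    by (induction k) (auto simp: that X')
  have comm: "word_eq ?R (?y # replicate k ?x @ v) (replicate k ?x' @ ?y # v)" for k v
  proof (induction k)
    case 0
    then show ?case by (simp add: word_eq.refl)
  next
    case (Suc k)
    have "word_eq ?R (?y # replicate (Suc k) ?x @ v) (?x' # ?y # replicate k ?x @ v)"
      using rel3[of "[]" "replicate k ?x @ v"] by simp
    also have "word_eq ?R \<dots> (?x' # replicate k ?x' @ ?y # v)"
      using word_eq_append_left[OF Suc, of "[?x']"] by simp
    finally (word_eq.trans) show ?case by simp
  qed
  have Y: "?y # u \<in> T" if "u \<in> T" for u
  proof (rule T_cons[OF that])
    fix p assume "p \<in> ?S"
    then obtain i b where p: "p = (i, b)" "0 \<le> i" "i < 2 * int n" by auto
    have y: "[?y] \<in> T" using nfI[of "(0, True)"] n by (simp add: dicyclic_nf_def)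
    have "dicyclic_nf (int n, False) \<in> T" by (rule nfI) (use n in auto)
    then have xn: "replicate n ?x \<in> T" by (simp add: dicyclic_nf_def)
    have "[?y, ?y] \<in> T" using T_eq[OF _ xn] rel2[of "[]" "[]"] by simp
    with y have "?y # (if b then [?y] else []) \<in> T" by auto
    from T_eq[OF comm X's[OF this]] show "?y # dicyclic_nf p \<in> T"
      by (simp add: dicyclic_nf_def p)
  qed
  have Y': "?y' # u \<in> T" if "u \<in> T" for u
  proof -
    have "word_eq ?R ([?y'] @ [?y, ?y] @ [?y, ?y] @ u) ([?y'] @ replicate n ?x @ [?y, ?y] @ u)"
      by (rule rel2)
    also have "word_eq ?R \<dots> ([?y'] @ replicate n ?x @ replicate n ?x @ u)"
      using rel2[of "[?y'] @ replicate n ?x" u] by simp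
    also (word_eq.trans) have "word_eq ?R \<dots> (?y' # u)"
      using rel1[of "[?y']" u] by (simp add: mult_2 replicate_add)
    finally (word_eq.trans) have 1: "word_eq ?R (?y' # u) ([?y'] @ [?y, ?y] @ [?y, ?y] @ u)"
      by (rule word_eq.sym)
    have "word_eq ?R ([?y'] @ [?y, ?y] @ [?y, ?y] @ u) (?y # ?y # ?y # u)"
      using word_eq.cancel[of ?R "[]" GY False "?y # ?y # ?y # u"] by simp
    with 1 have "word_eq ?R (?y' # u) (?y # ?y # ?y # u)" by (rule word_eq.trans)
    then show ?thesis by (rule T_eq) (intro Y that)
  qed
  have "u \<in> T"
  proof (induction u)
    case Nil
    then show ?case using nfI[of "(0, False)"] n by (simp add: dicyclic_nf_def)
  next
    case (Cons a u)
    obtain c s where "a = (c, s)" by (cases a)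
    with Cons show ?case by (cases c; cases s) (auto intro: X X' Y Y')
  qed
  then show ?thesis unfolding T_def by blast
qed

lemma group_dicyclic_group: "group (dicyclic_group n)"
  unfolding dicyclic_group_def by (rule group_presented_group)

lemma card_dicyclic_group:
  assumes "0 < n"
  shows "card (carrier (dicyclic_group n)) = 4 * n"
proof -
  have "carrier (dicyclic_group n) =
      (\<lambda>p. word_class (dicyclic_relations n) (dicyclic_nf p)) ` ({0..<2 * int n} \<times> UNIV)"
    (is "_ = ?f ` ?S")
  proof
    show "carrier (dicyclic_group n) \<subseteq> ?f ` ?S"
    proof
      fix A assume "A \<in> carrier (dicyclic_group n)"
      then obtain u where "A = word_class (dicyclic_relations n) u"
        by (auto simp: dicyclic_group_def presented_group_def)
      moreover obtain p where "p \<in> ?S" "word_eq (dicyclic_relations n) u (dicyclic_nf p)"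
        using dicyclic_nf_exists[OF assms] by blast
      ultimately show "A \<in> ?f ` ?S"
        by (intro image_eqI[of _ _ p]) (simp_all only: word_eq_class)
    qed
  next
    show "?f ` ?S \<subseteq> carrier (dicyclic_group n)"
      by (simp only: dicyclic_group_def presented_group_def partial_object.simps) blast
  qed
  then show ?thesis
    using card_image[OF dicyclic_nf_inj[OF assms]] by (simp add: card_cartesian_product)
qed

lemma sym_loopfree_generating_graph:
  "sym (parcs (generating_graph G))" "(g, g) \<notin> parcs (generating_graph G)"
  by (auto simp: generating_graph_def sym_def insert_commute)

end

theory Submission
  imports Defs
begin

text \<open>
  Write \<open>N = 2 n\<close> and let \<open>u\<close> be the indicator of the exponents \<open>i\<close> modulo \<open>N\<close> that are prime to
  \<open>n\<close>. Two rotations never generate; \<open>x\<^sup>i\<close> and \<open>x\<^sup>j y\<close> generate iff \<open>gcd(i, n) = 1\<close>, and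
  \<open>x\<^sup>i y\<close> and \<open>x\<^sup>j y\<close> iff \<open>gcd(i - j, n) = 1\<close>, since \<open>(x\<^sup>j y)\<^sup>2 = x\<^sup>n\<close>. Hence the adjacency
  matrix has the blocks \<open>0\<close>, the rank one matrix \<open>u 1\<^sup>T\<close>, its transpose, and a circulant matrix.
  The nontrivial characters of \<open>\<int>/N\<close>, placed on the coset of \<open>y\<close>, are eigenvectors whose
  eigenvalues are Ramanujan sums; the vectors on the rotations orthogonal to \<open>u\<close> form a kernel of
  dimension \<open>N - 1\<close>; the span of \<open>u\<close> and the constant function on the coset of \<open>y\<close> is invariant
  and contributes the roots of \<open>\<lambda>\<^sup>2 = 2 \<phi>(n) \<lambda> + 4 n \<phi>(n)\<close>.
\<close>

section \<open>The spectrum from an eigenbasis\<close>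

text \<open>The functions \<open>f j\<close> are the columns of a matrix \<open>P\<close> with
  \<open>A * P = P * D\<close>, where \<open>D\<close> is diagonal with entries \<open>ev j\<close>.
  Independence makes \<open>P\<close> invertible, so \<open>A\<close> is similar to \<open>D\<close>
  and has the same characteristic polynomial.\<close>

lemma proots_char_poly_eigenbasis:
  fixes a :: "'v \<Rightarrow> 'v \<Rightarrow> 'a::field" and f :: "'j \<Rightarrow> 'v \<Rightarrow> 'a" and ev :: "'j \<Rightarrow> 'a"
  assumes vs: "distinct vs" and J: "finite J" "card J = length vs"
    and eig: "\<And>j v. j \<in> J \<Longrightarrow> v \<in> set vs \<Longrightarrow> (\<Sum>w\<in>set vs. a v w * f j w) = ev j * f j v"
    and indep: "\<And>c j. (\<And>v. v \<in> set vs \<Longrightarrow> (\<Sum>j\<in>J. c j * f j v) = 0) \<Longrightarrow> j \<in> J \<Longrightarrow> c j = 0"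
  shows "proots (char_poly (mat (length vs) (length vs) (\<lambda>(r, s). a (vs ! r) (vs ! s))))
    = image_mset ev (mset_set J)"
proof -
  define N where "N = length vs"
  obtain js where js: "distinct js" "set js = J" using finite_distinct_list[OF J(1)] by blast
  have len: "length js = N" using J(2) distinct_card[OF js(1)] js(2) by (simp add: N_def)
  have sum_vs: "(\<Sum>s<N. g (vs ! s)) = (\<Sum>w\<in>set vs. g w)" for g :: "'v \<Rightarrow> 'a"
    using bij_betw_nth[OF vs HOL.refl HOL.refl] unfolding N_def by (intro sum.reindex_bij_betw)
  \<comment> \<open>The summand may depend on the position as well as on the element, because a
    coefficient vector indexed by positions has to be read as a function on
    \<open>J\<close>.\<close>
  have sum_js: "(\<Sum>s<N. g s (js ! s)) = (\<Sum>j\<in>J. g (inv_into {..<N} ((!) js) j) j)"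
    for g :: "nat \<Rightarrow> 'j \<Rightarrow> 'a"
  proof -
    have b: "bij_betw ((!) js) {..<N} J" using bij_betw_nth[OF js(1)] len js(2) by simp
    have "(\<Sum>j\<in>J. g (inv_into {..<N} ((!) js) j) j) =
        (\<Sum>s<N. g (inv_into {..<N} ((!) js) (js ! s)) (js ! s))"
      using sum.reindex_bij_betw[OF b, symmetric] .
    also have "\<dots> = (\<Sum>s<N. g s (js ! s))"
      by (rule sum.cong) (use b in \<open>auto simp: bij_betw_def inv_into_f_f\<close>)
    finally show ?thesis by simp
  qed
  define A where "A = mat N N (\<lambda>(r, s). a (vs ! r) (vs ! s))"
  define P where "P = mat N N (\<lambda>(r, s). f (js ! s) (vs ! r))"
  define D where "D = mat_diag N (\<lambda>s. ev (js ! s))"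
  have carr: "A \<in> carrier_mat N N" "P \<in> carrier_mat N N" "D \<in> carrier_mat N N"
    by (auto simp: A_def P_def D_def)
  have "A * P = P * D"
  proof (rule eq_matI)
    fix r s assume "r < dim_row (P * D)" "s < dim_col (P * D)"
    then have rs: "r < N" "s < N" by (auto simp: P_def D_def mat_diag_def)
    have "(A * P) $$ (r, s) = (\<Sum>t<N. a (vs ! r) (vs ! t) * f (js ! s) (vs ! t))"
      using rs by (simp add: A_def P_def scalar_prod_def atLeast0LessThan)
    also have "\<dots> = (\<Sum>w\<in>set vs. a (vs ! r) w * f (js ! s) w)"
      by (rule sum_vs)
    also have "\<dots> = ev (js ! s) * f (js ! s) (vs ! r)"
      using rs len js(2) by (intro eig) (auto simp: N_def)
    also have "\<dots> = (P * D) $$ (r, s)"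
      unfolding D_def using rs by (subst mat_diag_mult_right[OF carr(2)]) (auto simp: P_def)
    finally show "(A * P) $$ (r, s) = (P * D) $$ (r, s)" .
  qed (auto simp: A_def P_def D_def mat_diag_def)
  moreover have "det P \<noteq> 0"
  proof
    assume "det P = 0"
    then obtain v where v: "v \<in> carrier_vec N" "v \<noteq> 0\<^sub>v N" "P *\<^sub>v v = 0\<^sub>v N"
      using det_0_iff_vec_prod_zero_field[OF carr(2)] by blast
    \<comment> \<open>A nonzero kernel vector of \<open>P\<close> is a nontrivial linear relation
      among the \<open>f j\<close>, against \<open>indep\<close>.\<close>
    define c where "c j = v $ inv_into {..<N} ((!) js) j" for j
    have c_f: "(\<Sum>j\<in>J. c j * f j w) = 0" if "w \<in> set vs" for w
    proof -
      obtain r where r: "r < N" "w = vs ! r"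
        using \<open>w \<in> set vs\<close> by (auto simp: in_set_conv_nth N_def)
      have "(\<Sum>j\<in>J. c j * f j w) = (\<Sum>s<N. v $ s * f (js ! s) w)"
        unfolding c_def by (rule sum_js[symmetric])
      also have "\<dots> = (P *\<^sub>v v) $ r"
        using r v(1) by (simp add: P_def scalar_prod_def atLeast0LessThan mult.commute)
      finally show ?thesis using r v(3) by simp
    qed
    have c0: "c j = 0" if "j \<in> J" for j
      by (rule indep[OF _ that]) (rule c_f)
    have "v $ s = 0" if "s < N" for s
    proof -
      have "inj_on ((!) js) {..<N}" using js(1) len by (auto simp: inj_on_def nth_eq_iff_index_eq)
      with c0[of "js ! s"] that js(2) len show ?thesis by (auto simp: c_def inv_into_f_f)
    qed
    with v show False by (auto simp: vec_eq_iff)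
  qed
  then have "P \<in> Units (ring_mat TYPE('a) N ())" by (rule det_non_zero_imp_unit[OF carr(2)])
  then obtain Q where Q: "Q \<in> carrier_mat N N" "Q * P = 1\<^sub>m N" "P * Q = 1\<^sub>m N"
    unfolding Units_def ring_mat_def by auto
  ultimately have "A = P * D * Q"
    using assoc_mult_mat[OF carr(1,2) Q(1)] Q(3) right_mult_one_mat[OF carr(1)] by metis
  then have "similar_mat A D"
    unfolding similar_mat_def similar_mat_wit_def Let_def
    using carr Q by (intro exI[of _ P] exI[of _ Q]) auto
  then have "char_poly A = char_poly D" by (rule char_poly_similar)
  also have "\<dots> = (\<Prod>a\<leftarrow>diag_mat D. [:- a, 1:])"
    by (rule char_poly_upper_triangular[OF carr(3)]) (auto simp: D_def mat_diag_def)
  also have "diag_mat D = map ev js"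
    using len by (auto simp: diag_mat_def D_def mat_diag_def intro!: nth_equalityI)
  also have "proots (\<Prod>a\<leftarrow>map ev js. [:- a, 1:]) = mset (map ev js)"
  proof -
    have nz: "(\<Prod>a\<leftarrow>xs. [:- a, 1:]) \<noteq> 0" for xs :: "'a list"
      by (auto simp: prod_list_zero_iff)
    have "proots (\<Prod>a\<leftarrow>xs. [:- a, 1:]) = mset xs" for xs :: "'a list"
      by (induction xs) (simp_all add: proots_mult[OF _ nz] del: mult_pCons_left)
    then show ?thesis .
  qed
  also have "\<dots> = image_mset ev (mset_set J)"
    using js by (metis mset_map mset_set_set)
  finally show ?thesis unfolding A_def N_def .
qed

section \<open>Ramanujan sums\<close>

lemma sum_powers_root_of_unity:
  fixes z :: complex
  assumes "z ^ N = 1"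
  shows "(\<Sum>j<N. z ^ j) = (if z = 1 then of_nat N else 0)"
  using assms by (auto simp: sum_gp_strict)

lemma sum_multiples:
  fixes g :: "nat \<Rightarrow> 'a::comm_monoid_add"
  assumes "p > 0"
  shows "(\<Sum>j | j < p * M \<and> p dvd j. g j) = (\<Sum>j<M. g (p * j))"
  by (rule sum.reindex_bij_witness[of _ "\<lambda>j. p * j" "\<lambda>j. j div p"])
    (use assms in \<open>auto simp: less_mult_imp_div_less mult.commute\<close>)

text \<open>\<open>e\<close> is the order of \<open>z\<close>; \<open>P\<close> is adjoined prime by prime, sieving out its multiples.\<close>

lemma sieved_sum_root_of_unity:
  fixes z :: complex
  assumes "finite P" "\<And>p. p \<in> P \<Longrightarrow> prime p" "\<Prod>P dvd N"
    and "\<And>k. z ^ k = 1 \<longleftrightarrow> e dvd k" "e dvd N" "N > 0"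
  shows "(\<Sum>j | j < N \<and> (\<forall>p\<in>P. \<not> p dvd j). z ^ j) =
    (if e dvd \<Prod>P
     then (-1) ^ card {p\<in>P. p dvd e} * (of_nat N / of_nat e) *
       (\<Prod>p | p \<in> P \<and> \<not> p dvd e. 1 - 1 / of_nat p)
     else 0)"
  using assms
proof (induction P arbitrary: z e N rule: finite_induct)
  case empty
  have "(\<Sum>j<N. z ^ j) = (if z = 1 then of_nat N else 0)"
    using empty by (intro sum_powers_root_of_unity) simp
  moreover have "z = 1 \<longleftrightarrow> e = 1" using empty(3)[of 1] by simp
  ultimately show ?case by (simp add: lessThan_def)
next
  case (insert p P)
  have p: "prime p" "p > 0" and P: "\<And>q. q \<in> P \<Longrightarrow> prime q"
    using insert.prems(1) by (auto simp: prime_gt_0_nat)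
  have p1: "\<not> p dvd 1" using p(1) by auto
  have pr: "\<Prod>(insert p P) = p * \<Prod>P" using insert.hyps by simp
  have dN: "p * \<Prod>P dvd N" using insert.prems(2) pr by simp
  then obtain M where M: "N = p * M" using dvd_mult_left by blast
  have M0: "M > 0" using insert.prems(5) unfolding M by simp
  have PM: "\<Prod>P dvd M" using dN p unfolding M by simp
  have cop: "coprime q p" if "q \<in> P" for q
    using that insert.hyps P p(1) by (intro primes_coprime) auto
  have copP: "coprime p (\<Prod>P)"
    by (intro prod_coprime_right) (use cop coprime_commute in blast)
  have dvd_p: "q dvd p * j \<longleftrightarrow> q dvd j" if "q \<in> P" for q j
    using coprime_dvd_mult_right_iff[OF cop[OF that]] .
  let ?S = "\<lambda>z N. \<Sum>j | j < N \<and> (\<forall>q\<in>P. \<not> q dvd j). z ^ j"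
  \<comment> \<open>Sieving by one more prime: the terms at multiples \<open>p * j\<close> of
    \<open>p\<close> form the same sum for \<open>z ^ p\<close> with bound \<open>M\<close>, since
    for \<open>q \<in> P\<close> divisibility by \<open>q\<close> does not see the factor
    \<open>p\<close>.\<close>
  have "?S z N = (\<Sum>j | j < N \<and> (\<forall>q\<in>insert p P. \<not> q dvd j). z ^ j)
      + (\<Sum>j | j < N \<and> p dvd j \<and> (\<forall>q\<in>P. \<not> q dvd j). z ^ j)"
    by (subst sum.union_disjoint[symmetric]) (auto intro!: sum.cong)
  also have "(\<Sum>j | j < N \<and> p dvd j \<and> (\<forall>q\<in>P. \<not> q dvd j). z ^ j) =
      (\<Sum>j | j < p * M \<and> p dvd j. if \<forall>q\<in>P. \<not> q dvd j then z ^ j else 0)"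
    by (simp add: sum.If_cases M) (intro sum.cong; auto)
  also have "\<dots> = (\<Sum>j<M. if \<forall>q\<in>P. \<not> q dvd j then (z ^ p) ^ j else 0)"
    using p by (subst sum_multiples) (auto simp: power_mult dvd_p intro!: sum.cong)
  also have "\<dots> = ?S (z ^ p) M"
    by (simp add: sum.If_cases) (intro sum.cong; auto)
  finally have rec: "(\<Sum>j | j < N \<and> (\<forall>q\<in>insert p P. \<not> q dvd j). z ^ j) = ?S z N - ?S (z ^ p) M"
    by simp
  have PN: "\<Prod>P dvd N" using dN dvd_mult_right by blast
  note IH1 = insert.IH[OF P PN insert.prems(3,4,5)]
  show ?case
  proof (cases "p dvd e")
    \<comment> \<open>Here \<open>e\<close> cannot divide \<open>\<Prod>P\<close>, so the sum for
      \<open>z\<close> vanishes. Only minus the sum for \<open>z ^ p\<close> remains, whose order is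
      \<open>e / p\<close>; this is where the sign changes.\<close>
    case True
    then obtain e' where e': "e = p * e'" by blast
    have "\<not> e dvd \<Prod>P"
    proof
      assume "e dvd \<Prod>P"
      then have "p dvd \<Prod>P" using True dvd_trans by blast
      with copP p1 show False by (metis coprime_common_divisor dvd_refl)
    qed
    then have 1: "?S z N = 0" using IH1 by simp
    have ord: "(z ^ p) ^ k = 1 \<longleftrightarrow> e' dvd k" for k
      using insert.prems(3)[of "p * k"] p by (simp add: power_mult e')
    have "e' dvd M" using insert.prems(4) p by (simp add: e' M)
    note IH2 = insert.IH[OF P PM ord this M0]
    have iff: "e dvd \<Prod>(insert p P) \<longleftrightarrow> e' dvd \<Prod>P"
      unfolding pr e' using p by simp
    have d: "q dvd e \<longleftrightarrow> q dvd e'" if "q \<in> P" for q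
      unfolding e' using dvd_p[OF that] .
    have "{q \<in> insert p P. q dvd e} = insert p {q \<in> P. q dvd e'}" using True d by auto
    then have c: "card {q \<in> insert p P. q dvd e} = Suc (card {q \<in> P. q dvd e'})"
      using insert.hyps by simp
    have s: "{q. q \<in> insert p P \<and> \<not> q dvd e} = {q. q \<in> P \<and> \<not> q dvd e'}" using True d by auto
    have "(of_nat N :: complex) / of_nat e = of_nat M / of_nat e'"
      using p by (simp add: M e')
    with IH2 show ?thesis
      unfolding rec 1 iff c s by simp
  next
    \<comment> \<open>Now \<open>z ^ p\<close> still has order \<open>e\<close>, and the two sums
      differ only by the factor \<open>M / N = 1 / p\<close>. Their difference carries the new
      factor \<open>1 - 1 / p\<close>.\<close>
    case False
    then have ce: "coprime e p" using p(1) prime_imp_coprime coprime_commute by blast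
    have ord: "(z ^ p) ^ k = 1 \<longleftrightarrow> e dvd k" for k
      using insert.prems(3)[of "p * k"] coprime_dvd_mult_right_iff[OF ce, of k]
      by (simp add: power_mult)
    have "e dvd M"
      using insert.prems(4) coprime_dvd_mult_right_iff[OF ce] unfolding M by blast
    note IH2 = insert.IH[OF P PM ord this M0]
    have iff: "e dvd \<Prod>(insert p P) \<longleftrightarrow> e dvd \<Prod>P"
      unfolding pr by (rule coprime_dvd_mult_right_iff[OF ce])
    have s: "{q \<in> insert p P. q dvd e} = {q \<in> P. q dvd e}" using False by auto
    have "{q. q \<in> insert p P \<and> \<not> q dvd e} = insert p {q. q \<in> P \<and> \<not> q dvd e}"
      using False by auto
    then have t: "(\<Prod>q | q \<in> insert p P \<and> \<not> q dvd e. 1 - 1 / of_nat q :: complex) =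
        (1 - 1 / of_nat p) * (\<Prod>q | q \<in> P \<and> \<not> q dvd e. 1 - 1 / of_nat q)"
      using insert.hyps by simp
    have M': "(of_nat M :: complex) = of_nat N / of_nat p"
      using p by (simp add: M)
    from IH1 IH2 show ?thesis
      unfolding rec iff s t M' by (simp add: algebra_simps)
  qed
qed

section \<open>The radical of \<open>n\<close> and the closed form of the Ramanujan sums\<close>

lemma prod_prime_factors_dvd: "\<Prod>(prime_factors n) dvd (n::nat)"
proof (cases "n = 0")
  case False
  have "\<Prod>(prime_factors n) dvd (\<Prod>p\<in>prime_factors n. p ^ multiplicity p n)"
    by (rule prod_dvd_prod) (auto simp: prime_factors_multiplicity intro!: dvd_power)
  with False show ?thesis by (simp add: prod_prime_factors)
qed simp

lemma squarefree_prod_prime_factors: "squarefree (\<Prod>(prime_factors n) :: nat)"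
  by (rule squarefree_prod_coprime) (auto intro: primes_coprime squarefree_prime)

text \<open>Euler's product formula for \<open>n\<close> and for \<open>e\<close>: the factors at
  primes dividing \<open>e\<close> cancel. The right-hand side is the shape in which the sieve
  delivers its value.\<close>

lemma totient_split:
  fixes n e :: nat
  assumes "n > 0" "e dvd n"
  shows "of_nat (totient n) / of_nat (totient e) =
    (of_nat n / of_nat e) * (\<Prod>p | p \<in> prime_factors n \<and> \<not> p dvd e. 1 - 1 / of_nat p :: complex)"
proof -
  have e0: "e > 0" using assms by (auto intro: Nat.gr0I)
  have T: "of_nat (totient m) = of_nat m * (\<Prod>p\<in>prime_factors m. 1 - 1 / of_nat p :: complex)" for m
    using arg_cong[OF totient_formula2[of m], of complex_of_real] by simp
  have pe: "prime_factors e = {p\<in>prime_factors n. p dvd e}"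
    using assms e0 by (auto simp: in_prime_factors_iff intro: dvd_trans)
  have "(\<Prod>p\<in>prime_factors n. 1 - 1 / of_nat p :: complex) =
      (\<Prod>p\<in>prime_factors e \<union> {p. p \<in> prime_factors n \<and> \<not> p dvd e}. 1 - 1 / of_nat p)"
    by (rule prod.cong) (auto simp: pe)
  also have "\<dots> = (\<Prod>p\<in>prime_factors e. 1 - 1 / of_nat p) *
      (\<Prod>p | p \<in> prime_factors n \<and> \<not> p dvd e. 1 - 1 / of_nat p)"
    by (rule prod.union_disjoint) (auto simp: pe)
  finally have "of_nat (totient n) = of_nat n * ((\<Prod>p\<in>prime_factors e. 1 - 1 / of_nat p) *
      (\<Prod>p | p \<in> prime_factors n \<and> \<not> p dvd e. 1 - 1 / of_nat p :: complex))"
    by (simp add: T)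
  moreover have "(\<Prod>p\<in>prime_factors e. 1 - 1 / of_nat p :: complex) \<noteq> 0"
    using T[of e] e0 by (metis mult_zero_right of_nat_0_less_iff of_nat_eq_0_iff totient_gt_0_iff less_irrefl)
  ultimately show ?thesis using e0 by (simp add: T[of e])
qed

text \<open>Sieve by the prime factors of \<open>n\<close>. An order \<open>e\<close> dividing the
  radical is squarefree, so the sign of the sieve is \<open>moebius_mu e\<close>. The range is
  \<open>N\<close> rather than \<open>n\<close> to allow for the characters modulo
  \<open>2 * n\<close>.\<close>

lemma sum_coprime_root_of_unity:
  fixes z :: complex
  assumes n: "n > 0" and N: "n dvd N" "N > 0"
    and z: "\<And>k. z ^ k = 1 \<longleftrightarrow> e dvd k" and e: "e dvd N"
  shows "(\<Sum>j | j < N \<and> coprime j n. z ^ j) =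
    (if e dvd \<Prod>(prime_factors n)
     then of_nat (N div n) * (of_int (moebius_mu e) * (of_nat (totient n) / of_nat (totient e)))
     else 0)"
proof -
  let ?P = "prime_factors n"
  have P: "\<And>p. p \<in> ?P \<Longrightarrow> prime p" by auto
  have PN: "\<Prod>?P dvd N" using prod_prime_factors_dvd N(1) by (rule dvd_trans)
  have cop: "coprime j n \<longleftrightarrow> (\<forall>p\<in>?P. \<not> p dvd j)" for j
  proof
    assume "coprime j n"
    then show "\<forall>p\<in>?P. \<not> p dvd j"
      by (metis coprime_common_divisor in_prime_factors_iff not_prime_unit)
  next
    assume *: "\<forall>p\<in>?P. \<not> p dvd j"
    show "coprime j n"
    proof (rule ccontr)
      assume "\<not> coprime j n"
      then have "gcd j n \<noteq> 1" by (simp add: coprime_iff_gcd_eq_1)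
      then obtain p where "prime p" "p dvd gcd j n" using prime_factor_nat by blast
      with * n show False by (auto simp: in_prime_factors_iff)
    qed
  qed
  have *: "(\<Sum>j | j < N \<and> coprime j n. z ^ j) = (\<Sum>j | j < N \<and> (\<forall>p\<in>?P. \<not> p dvd j). z ^ j)"
    unfolding cop ..
  show ?thesis
  proof (cases "e dvd \<Prod>?P")
    case True
    have en: "e dvd n" using True prod_prime_factors_dvd by (rule dvd_trans)
    then have e0: "e > 0" using n by (auto intro: Nat.gr0I)
    have pe: "prime_factors e = {p\<in>?P. p dvd e}"
      using en n e0 by (auto simp: in_prime_factors_iff intro: dvd_trans)
    have mu: "moebius_mu e = (-1) ^ card {p\<in>?P. p dvd e}"
      using squarefree_mono[OF True squarefree_prod_prime_factors] by (simp add: moebius_mu_def pe)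
    have Nn: "(of_nat N :: complex) = of_nat (N div n) * of_nat n"
      using N by (metis dvd_div_mult_self of_nat_mult)
    show ?thesis
      unfolding * totient_split[OF n en] mu
      using sieved_sum_root_of_unity[OF _ P PN z e N(2)] True
      by (simp add: Nn)
  next
    case False
    then show ?thesis
      unfolding * using sieved_sum_root_of_unity[OF _ P PN z e N(2)] by simp
  qed
qed

section \<open>Generating pairs of the dicyclic group\<close>

text \<open>The element \<open>x\<^sup>k y\<^sup>b\<close>.\<close>

definition dicyclic_elem :: "nat \<Rightarrow> int \<Rightarrow> bool \<Rightarrow> dicyclic_gen word set" where
  "dicyclic_elem n k b = word_class (dicyclic_relations n) (dicyclic_nf (k mod (2 * int n), b))"

text \<open>The multiplication table of normal forms: \<open>y\<close> inverts the rotation it moves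
  past, and a second \<open>y\<close> turns into \<open>x\<^sup>n\<close>.\<close>

lemma foldr_dicyclic_act_nf:
  assumes "n > 0" "i \<in> {0..<2 * int n}" "j \<in> {0..<2 * int n}"
  shows "foldr (dicyclic_act n) (dicyclic_nf (i, b)) (j, c) =
    ((i + (if b then if c then int n - j else - j else j)) mod (2 * int n), b \<noteq> c)"
  using assms by (auto simp: dicyclic_nf_def funpow_dicyclic_act_X mod_simps algebra_simps)

text \<open>Every word equals some normal form, and the action respects equality of words; so acting
  on \<open>(0, False)\<close>, the coordinates of the identity, computes that normal form.\<close>

lemma word_class_dicyclic:
  assumes n: "n > 0"
  shows "word_class (dicyclic_relations n) u =
    word_class (dicyclic_relations n) (dicyclic_nf (foldr (dicyclic_act n) u (0, False)))"
proof -
  obtain i b where p: "i \<in> {0..<2 * int n}" "word_eq (dicyclic_relations n) u (dicyclic_nf (i, b))"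
    using dicyclic_nf_exists[OF n, of u] by auto
  have "foldr (dicyclic_act n) u (0, False) = (i, b)"
    using dicyclic_act_word_eq[OF n p(2), of "(0, False)"] foldr_dicyclic_act_nf[OF n p(1), of 0 b False] n p(1)
    by auto
  with p(2) show ?thesis by (simp add: word_eq_class)
qed

lemma dicyclic_elem_mult:
  assumes n: "n > 0"
  shows "dicyclic_elem n k b \<otimes>\<^bsub>dicyclic_group n\<^esub> dicyclic_elem n l c =
    dicyclic_elem n (k + (if b then if c then int n - l else - l else l)) (b \<noteq> c)"
proof -
  have r: "m mod (2 * int n) \<in> {0..<2 * int n}" for m using n by simp
  have "(k + (int n - l mod (2 * int n))) mod (2 * int n) = (k + (int n - l)) mod (2 * int n)"
    by (metis mod_add_right_eq mod_diff_right_eq)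
  then show ?thesis
    using foldr_dicyclic_act_nf[OF n r[of l], of 0 c False] n
    unfolding dicyclic_elem_def dicyclic_group_def presented_group_mult
    by (subst word_class_dicyclic[OF n])
      (simp add: foldr_dicyclic_act_nf[OF n r r] mod_simps)
qed

lemma dicyclic_elem_eq_iff:
  assumes n: "n > 0"
  shows "dicyclic_elem n k b = dicyclic_elem n l c \<longleftrightarrow> 2 * int n dvd k - l \<and> b = c"
proof -
  have "(m mod (2 * int n), d) \<in> {0..<2 * int n} \<times> UNIV" for m and d :: bool using n by simp
  from inj_on_eq_iff[OF dicyclic_nf_inj[OF n] this this, of k b l c] show ?thesis
    by (auto simp: dicyclic_elem_def mod_eq_dvd_iff)
qed

lemma carrier_dicyclic_group:
  assumes n: "n > 0"
  shows "carrier (dicyclic_group n) = {dicyclic_elem n k b | k b. True}"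
proof (intro equalityI subsetI)
  fix g assume "g \<in> carrier (dicyclic_group n)"
  then obtain u where "g = word_class (dicyclic_relations n) u"
    by (auto simp: dicyclic_group_def presented_group_def)
  moreover obtain i b where "i \<in> {0..<2 * int n}"
      "word_eq (dicyclic_relations n) u (dicyclic_nf (i, b))"
    using dicyclic_nf_exists[OF n, of u] by auto
  ultimately have "g = dicyclic_elem n i b" by (simp add: dicyclic_elem_def word_eq_class)
  then show "g \<in> {dicyclic_elem n k b | k b. True}" by blast
qed (auto simp: dicyclic_group_def presented_group_def dicyclic_elem_def)

lemma dicyclic_elem_carrier [simp]:
  "n > 0 \<Longrightarrow> dicyclic_elem n k b \<in> carrier (dicyclic_group n)"
  by (auto simp: carrier_dicyclic_group)

lemma one_dicyclic_group: "\<one>\<^bsub>dicyclic_group n\<^esub> = dicyclic_elem n 0 False"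
  by (simp add: dicyclic_group_def presented_group_def dicyclic_elem_def dicyclic_nf_def)

text \<open>Since \<open>x\<^sup>k y\<close> has square \<open>x\<^sup>n\<close>, an involution, its
  inverse is \<open>x\<^sup>n x\<^sup>k y\<close>.\<close>

lemma inv_dicyclic_elem:
  assumes n: "n > 0"
  shows "inv\<^bsub>dicyclic_group n\<^esub> dicyclic_elem n k b =
    dicyclic_elem n (if b then k + int n else - k) b"
  using n by (intro group.inv_equality[OF group_dicyclic_group])
    (auto simp: dicyclic_elem_mult one_dicyclic_group dicyclic_elem_eq_iff)

text \<open>The exponents of the rotations in \<open>K\<close> form an ideal of the integers. It
  contains \<open>k\<close>, and also \<open>n\<close> as the exponent of the square of
  \<open>x\<^sup>j y\<close>; by Bezout it contains 1. Multiplying the rotations by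
  \<open>x\<^sup>j y\<close> gives the other coset.\<close>

lemma subgroup_dicyclic_eq_carrier:
  assumes n: "n > 0" and K: "subgroup K (dicyclic_group n)"
    and k: "dicyclic_elem n k False \<in> K" "coprime k (int n)" and j: "dicyclic_elem n j True \<in> K"
  shows "K = carrier (dicyclic_group n)"
proof -
  define S where "S = {m. dicyclic_elem n m False \<in> K}"
  have add: "a + b \<in> S" if "a \<in> S" "b \<in> S" for a b
    using subgroup.m_closed[OF K, of "dicyclic_elem n a False" "dicyclic_elem n b False"] that n
    by (simp add: S_def dicyclic_elem_mult)
  have neg: "- a \<in> S" if "a \<in> S" for a
    using subgroup.m_inv_closed[OF K, of "dicyclic_elem n a False"] that n
    by (simp add: S_def inv_dicyclic_elem)
  have zero: "0 \<in> S"
    using subgroup.one_closed[OF K] by (simp add: S_def one_dicyclic_group)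
  have mult: "m * a \<in> S" if a: "a \<in> S" for a m
  proof (induction m rule: int_induct[where k = 0])
    case base
    then show ?case using zero by simp
  next
    case (step1 i)
    then show ?case using add[OF _ a, of "i * a"] by (simp add: algebra_simps)
  next
    case (step2 i)
    then show ?case using add[OF _ neg[OF a], of "i * a"] by (simp add: algebra_simps)
  qed
  have "int n \<in> S"
    using subgroup.m_closed[OF K j j] n by (simp add: S_def dicyclic_elem_mult)
  moreover have "k \<in> S" using k(1) by (simp add: S_def)
  moreover obtain u v where "u * k + v * int n = 1"
    using bezout_int[of k "int n"] k(2) by auto
  ultimately have "1 \<in> S" using add[OF mult mult, of k "int n" u v] by simp
  then have S: "m \<in> S" for m using mult[of 1 m] by simp
  have "dicyclic_elem n m b \<in> K" for m b
  proof (cases b)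
    case True
    then show ?thesis
      using subgroup.m_closed[OF K _ j, of "dicyclic_elem n (m - j) False"] S[of "m - j"] n
      by (simp add: S_def dicyclic_elem_mult)
  qed (use S[of m] in \<open>simp add: S_def\<close>)
  then show ?thesis
    using subgroup.subset[OF K] n by (auto simp: carrier_dicyclic_group)
qed

text \<open>This is the subgroup generated by \<open>x\<^sup>d\<close> and
  \<open>x\<^sup>j y\<close>, the obstruction to generation. That \<open>d\<close> divides
  \<open>n\<close> keeps it closed, as squares outside the rotations equal
  \<open>x\<^sup>n\<close>.\<close>

lemma dicyclic_subgroup_mod:
  assumes n: "n > 0" and d: "d dvd int n"
  shows "subgroup {dicyclic_elem n k b | k b. d dvd (if b then k - j else k)} (dicyclic_group n)"
    (is "subgroup ?H _")
proof (rule group.subgroupI[OF group_dicyclic_group])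
  show "?H \<subseteq> carrier (dicyclic_group n)" using n by auto
  have "d dvd (if False then 0 - j else 0)" by simp
  then show "?H \<noteq> {}" by blast
next
  fix g assume "g \<in> ?H"
  then obtain k b where g: "g = dicyclic_elem n k b" "d dvd (if b then k - j else k)" by blast
  have "d dvd k + int n - j" if b
    using dvd_add[of d "k - j" "int n"] g(2) d that by (simp add: algebra_simps)
  then have "d dvd (if b then (if b then k + int n else - k) - j else (if b then k + int n else - k))"
    using g(2) by auto
  then show "inv\<^bsub>dicyclic_group n\<^esub> g \<in> ?H"
    unfolding g(1) inv_dicyclic_elem[OF n] by blast
next
  fix g h assume "g \<in> ?H" "h \<in> ?H"
  then obtain k b l c where g: "g = dicyclic_elem n k b" "d dvd (if b then k - j else k)"
    and h: "h = dicyclic_elem n l c" "d dvd (if c then l - j else l)" by blast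
  let ?m = "k + (if b then if c then int n - l else - l else l)"
  \<comment> \<open>For two factors outside the rotations the exponent is
    \<open>(k - j) - (l - j) + int n\<close>; the other combinations serve the remaining
    cases.\<close>
  have "d dvd (if b \<noteq> c then ?m - j else ?m)"
    using g(2) h(2) d dvd_add[of d k l] dvd_add[of d k "l - j"] dvd_diff[of d "k - j" l]
      dvd_add[of d "(k - j) - (l - j)" "int n"] dvd_diff[of d "k - j" "l - j"]
    by (auto simp: algebra_simps)
  then show "g \<otimes>\<^bsub>dicyclic_group n\<^esub> h \<in> ?H"
    unfolding g(1) h(1) dicyclic_elem_mult[OF n] by blast
qed

text \<open>Both generators lie in the subgroup attached to \<open>d\<close> and \<open>j\<close>,
  which is therefore everything and contains \<open>x\<close>. As \<open>d\<close> divides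
  \<open>2 * n\<close>, it must divide the exponent 1.\<close>

lemma generate_dicyclic_coprime:
  assumes n: "n > 0" and d: "d dvd int n"
    and gen: "generate (dicyclic_group n) {g, h} = carrier (dicyclic_group n)"
    and g: "g = dicyclic_elem n k b" "d dvd (if b then k - j else k)"
    and h: "h = dicyclic_elem n l c" "d dvd (if c then l - j else l)"
  shows "d dvd 1"
proof -
  let ?H = "{dicyclic_elem n k b | k b. d dvd (if b then k - j else k)}"
  have "g \<in> ?H" "h \<in> ?H" using g h by blast+
  then have "{g, h} \<subseteq> ?H" by simp
  then have "generate (dicyclic_group n) {g, h} \<subseteq> ?H"
    by (rule group.generate_subgroup_incl[OF group_dicyclic_group _ dicyclic_subgroup_mod[OF n d]])
  then have "carrier (dicyclic_group n) \<subseteq> ?H" unfolding gen .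
  then have "dicyclic_elem n 1 False \<in> ?H" using dicyclic_elem_carrier[OF n] by (rule subsetD)
  then obtain m b' where m: "dicyclic_elem n 1 False = dicyclic_elem n m b'"
      "d dvd (if b' then m - j else m)"
    by blast
  then have m: "d dvd m" "2 * int n dvd 1 - m"
    by (simp_all add: dicyclic_elem_eq_iff[OF n])
  have "d dvd 2 * int n" using d by simp
  then have "d dvd 1 - m" using m(2) dvd_trans by blast
  with m(1) show ?thesis using dvd_add[of d "1 - m" m] by simp
qed

lemma generate_dicyclic_rotations:
  assumes n: "n > 0"
  shows "generate (dicyclic_group n) {dicyclic_elem n k False, dicyclic_elem n l False}
    \<noteq> carrier (dicyclic_group n)"
proof -
  let ?H = "{dicyclic_elem n k False | k. True}"
  have "subgroup ?H (dicyclic_group n)"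
    by (rule group.subgroupI[OF group_dicyclic_group])
      (use n in \<open>auto simp: dicyclic_elem_mult inv_dicyclic_elem\<close>)
  then have "generate (dicyclic_group n) {dicyclic_elem n k False, dicyclic_elem n l False} \<subseteq> ?H"
    by (intro group.generate_subgroup_incl[OF group_dicyclic_group]) auto
  moreover have "dicyclic_elem n 0 True \<notin> ?H" by (auto simp: dicyclic_elem_eq_iff[OF n])
  ultimately show ?thesis using dicyclic_elem_carrier[OF n] by blast
qed

lemma generate_dicyclic_mixed:
  assumes n: "n > 0"
  shows "generate (dicyclic_group n) {dicyclic_elem n k False, dicyclic_elem n l True}
      = carrier (dicyclic_group n) \<longleftrightarrow> coprime k (int n)"
    (is "generate _ ?A = _ \<longleftrightarrow> _")
proof
  assume "generate (dicyclic_group n) ?A = carrier (dicyclic_group n)"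
  \<comment> \<open>The subgroup attached to \<open>gcd k (int n)\<close> and \<open>l\<close>
    contains both generators.\<close>
  from generate_dicyclic_coprime[OF n _ this HOL.refl _ HOL.refl, of "gcd k (int n)" l]
  show "coprime k (int n)" by (simp add: coprime_iff_gcd_eq_1)
next
  assume *: "coprime k (int n)"
  have "subgroup (generate (dicyclic_group n) ?A) (dicyclic_group n)"
    using n by (intro group.generate_is_subgroup[OF group_dicyclic_group]) auto
  then show "generate (dicyclic_group n) ?A = carrier (dicyclic_group n)"
    by (rule subgroup_dicyclic_eq_carrier[OF n _ _ *]) (auto intro: generate.incl)
qed

text \<open>The product of the two generators is the rotation with exponent
  \<open>k + n - l\<close>, and the shift by \<open>n\<close> does not affect coprimality to
  \<open>n\<close>. For the converse, both lie in the subgroup attached to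
  \<open>gcd (k - l) (int n)\<close> and \<open>l\<close>.\<close>

lemma generate_dicyclic_reflections:
  assumes n: "n > 0"
  shows "generate (dicyclic_group n) {dicyclic_elem n k True, dicyclic_elem n l True}
      = carrier (dicyclic_group n) \<longleftrightarrow> coprime (k - l) (int n)"
    (is "generate _ ?A = _ \<longleftrightarrow> _")
proof
  assume "generate (dicyclic_group n) ?A = carrier (dicyclic_group n)"
  from generate_dicyclic_coprime[OF n _ this HOL.refl _ HOL.refl, of "gcd (k - l) (int n)" l]
  show "coprime (k - l) (int n)" by (simp add: coprime_iff_gcd_eq_1)
next
  assume "coprime (k - l) (int n)"
  then have "coprime (k - l + int n) (int n)" by (simp add: coprime_iff_gcd_eq_1)
  then have *: "coprime (k + (int n - l)) (int n)" by (simp add: algebra_simps)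
  have K: "subgroup (generate (dicyclic_group n) ?A) (dicyclic_group n)"
    using n by (intro group.generate_is_subgroup[OF group_dicyclic_group]) auto
  have kl: "dicyclic_elem n k True \<in> generate (dicyclic_group n) ?A"
    "dicyclic_elem n l True \<in> generate (dicyclic_group n) ?A"
    by (auto intro: generate.incl)
  from subgroup.m_closed[OF K this]
  have "dicyclic_elem n (k + (int n - l)) False \<in> generate (dicyclic_group n) ?A"
    by (simp add: dicyclic_elem_mult[OF n])
  then show "generate (dicyclic_group n) ?A = carrier (dicyclic_group n)"
    by (rule subgroup_dicyclic_eq_carrier[OF n K _ * kl(1)])
qed

section \<open>The generating graph in the coordinates \<open>(i, b)\<close> of
  \<open>x\<^sup>i y\<^sup>b\<close>\<close>

fun dicyclic_adj :: "nat \<Rightarrow> nat \<times> bool \<Rightarrow> nat \<times> bool \<Rightarrow> bool" where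
  "dicyclic_adj n (i, b) (j, c) =
    (if b then if c then coprime (int i - int j) (int n) else coprime j n
     else c \<and> coprime i n)"

lemma parcs_generating_graph_dicyclic:
  assumes n: "n \<ge> 2"
  shows "(dicyclic_elem n (int i) b, dicyclic_elem n (int j) c)
      \<in> parcs (generating_graph (dicyclic_group n)) \<longleftrightarrow> dicyclic_adj n (i, b) (j, c)"
proof -
  have n0: "n > 0" using n by simp
  \<comment> \<open>Edges require distinct vertices; for two elements outside the rotations this
    follows from coprimality, because \<open>n \<ge> 2\<close>.\<close>
  have "\<not> 2 * int n dvd int i - int j" if "coprime (int i - int j) (int n)"
  proof
    assume "2 * int n dvd int i - int j"
    then have "int n dvd int i - int j" by (rule dvd_mult_right)
    with that have "int n dvd 1" using coprime_common_divisor[OF that, of "int n"] by simp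
    with n show False by simp
  qed
  then show ?thesis
    using n0 generate_dicyclic_mixed[OF n0, of "int j" "int i"]
    by (cases b; cases c)
      (auto simp: generating_graph_def dicyclic_elem_eq_iff generate_dicyclic_rotations
        generate_dicyclic_mixed generate_dicyclic_reflections insert_commute)
qed

lemma bij_betw_dicyclic_elem:
  assumes n: "n > 0"
  shows "bij_betw (\<lambda>(i, b). dicyclic_elem n (int i) b) ({..<2 * n} \<times> UNIV) (carrier (dicyclic_group n))"
proof (rule bij_betw_imageI)
  show "inj_on (\<lambda>(i, b). dicyclic_elem n (int i) b) ({..<2 * n} \<times> UNIV)"
  proof (rule inj_onI, clarify)
    fix i j b c assume *: "i < 2 * n" "j < 2 * n" "dicyclic_elem n (int i) b = dicyclic_elem n (int j) c"
    then have "2 * int n dvd int i - int j" using n by (simp add: dicyclic_elem_eq_iff)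
    then have "int i mod (2 * int n) = int j mod (2 * int n)" by (simp only: mod_eq_dvd_iff)
    then have "i = j" using *(1,2) by simp
    with *(3) show "i = j \<and> b = c" using n by (simp add: dicyclic_elem_eq_iff)
  qed
  show "(\<lambda>(i, b). dicyclic_elem n (int i) b) ` ({..<2 * n} \<times> UNIV) = carrier (dicyclic_group n)"
  proof (intro equalityI subsetI)
    fix g assume "g \<in> carrier (dicyclic_group n)"
    then obtain k b where g: "g = dicyclic_elem n k b" using n by (auto simp: carrier_dicyclic_group)
    have k: "0 \<le> k mod (2 * int n)" "k mod (2 * int n) < 2 * int n" using n by auto
    have "g = dicyclic_elem n (int (nat (k mod (2 * int n)))) b"
      unfolding g dicyclic_elem_def using k by simp
    moreover have "nat (k mod (2 * int n)) < 2 * n" using k by linarith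
    ultimately show "g \<in> (\<lambda>(i, b). dicyclic_elem n (int i) b) ` ({..<2 * n} \<times> UNIV)"
      by (intro image_eqI[of _ _ "(nat (k mod (2 * int n)), b)"]) auto
  qed (use n in auto)
qed

section \<open>Eigenvectors of the generating graph\<close>

lemma primitive_root_of_unity_exists:
  assumes N: "N > 0"
  obtains w :: complex where "\<And>k. w ^ k = 1 \<longleftrightarrow> N dvd k"
proof
  let ?w = "cis (2 * pi / N)"
  have pow: "?w ^ k = cis (2 * pi * real k / real N)" for k
    by (simp add: DeMoivre field_simps)
  note bij = bij_betw_roots_unity[OF N]
  have inj: "inj_on (\<lambda>k. ?w ^ k) {..<N}"
    unfolding pow using bij by (rule bij_betw_imp_inj_on)
  have wN: "?w ^ N = 1" using N by (simp add: pow)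
  fix k
  have "?w ^ k = ?w ^ (N * (k div N) + k mod N)" by simp
  also have "\<dots> = ?w ^ (k mod N)" by (simp only: power_add power_mult wN) simp
  finally have "?w ^ k = 1 \<longleftrightarrow> ?w ^ (k mod N) = ?w ^ 0" by simp
  also have "\<dots> \<longleftrightarrow> k mod N = 0"
    using inj_on_eq_iff[OF inj, of "k mod N" 0] N by simp
  finally show "?w ^ k = 1 \<longleftrightarrow> N dvd k" by (simp add: dvd_eq_mod_eq_0)
qed

lemma inj_on_power_root_of_unity:
  fixes w :: complex
  assumes w: "\<And>k. w ^ k = 1 \<longleftrightarrow> N dvd k" and N: "N > 0"
  shows "inj_on (\<lambda>k. w ^ k) {..<N}"
proof (rule linorder_inj_onI)
  fix i j assume ij: "i < j" "i \<in> {..<N}" "j \<in> {..<N}"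
  have "w \<noteq> 0" using w[of N] N by (auto simp: power_0_left)
  moreover have "w ^ j = w ^ i * w ^ (j - i)" using ij by (simp flip: power_add)
  moreover have "w ^ (j - i) \<noteq> 1" using ij by (auto simp: w dest: dvd_imp_le)
  ultimately show "w ^ i \<noteq> w ^ j" by simp
qed auto

text \<open>A Vandermonde argument: the \<open>c l\<close> are the coefficients of a polynomial of
  degree below \<open>N\<close> that vanishes at the \<open>N\<close> distinct points
  \<open>w ^ k\<close>.\<close>

lemma dft_eq_0_imp_eq_0:
  fixes w :: complex
  assumes w: "\<And>k. w ^ k = 1 \<longleftrightarrow> N dvd k"
    and c: "\<And>k. k < N \<Longrightarrow> (\<Sum>l<N. c l * (w ^ l) ^ k) = 0" and l: "l < N"
  shows "c l = 0"
proof -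
  define p where "p = (\<Sum>l<N. monom (c l) l)"
  have "p = 0"
  proof (rule poly_eqI_degree[of "(\<lambda>k. w ^ k) ` {..<N}"])
    have "degree p \<le> N - 1" unfolding p_def
      by (rule degree_sum_le) (auto intro: order.trans[OF degree_monom_le])
    moreover have "card ((\<lambda>k. w ^ k) ` {..<N}) = N"
      using inj_on_power_root_of_unity[OF w] l by (simp add: card_image)
    ultimately show "degree p < card ((\<lambda>k. w ^ k) ` {..<N})"
      "degree (0 :: complex poly) < card ((\<lambda>k. w ^ k) ` {..<N})"
      using l by simp_all
    fix x assume "x \<in> (\<lambda>k. w ^ k) ` {..<N}"
    then obtain k where k: "k < N" "x = w ^ k" by blast
    have "(w ^ l) ^ k = (w ^ k) ^ l" for l by (simp flip: power_mult add: mult.commute)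
    with c[OF k(1)] show "poly p x = poly 0 x"
      by (simp add: p_def poly_sum poly_monom k(2))
  qed
  moreover have "coeff p l = c l"
    using l by (simp add: p_def coeff_sum)
  ultimately show ?thesis by simp
qed

text \<open>Substitute \<open>k = (t + i) mod N\<close>: coprimality to \<open>n\<close> depends
  only on the residue modulo \<open>n\<close>, a divisor of \<open>N\<close>, and not on the sign.
  So powers of \<open>z\<close> form an eigenvector of the circulant block.\<close>

lemma circulant_coprime_sum:
  fixes z :: complex
  assumes n: "n > 0" and N: "n dvd N" "N > 0" and z: "z ^ N = 1"
  shows "(\<Sum>k<N. of_bool (coprime (int i - int k) (int n)) * z ^ k) =
    z ^ i * (\<Sum>t | t < N \<and> coprime t n. z ^ t)"
proof -
  note [simp del] = sum_of_bool_eq sum_mult_of_bool_eq sum_of_bool_mult_eq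
  have zmod: "z ^ (m mod N) = z ^ m" for m
  proof -
    have "z ^ m = z ^ (N * (m div N) + m mod N)" by simp
    also have "\<dots> = z ^ (m mod N)" by (simp only: power_add power_mult z) simp
    finally show ?thesis by simp
  qed
  have inj: "inj_on (\<lambda>t. (t + i) mod N) {..<N}"
  proof (rule inj_onI)
    fix s t assume "s \<in> {..<N}" "t \<in> {..<N}" "(s + i) mod N = (t + i) mod N"
    then show "s = t"
      by (metis cong_add_rcancel_nat cong_def lessThan_iff mod_less)
  qed
  have bij: "bij_betw (\<lambda>t. (t + i) mod N) {..<N} {..<N}"
    unfolding bij_betw_def using N by (intro conjI inj endo_inj_surj) auto
  have cop: "coprime (int i - int ((t + i) mod N)) (int n) \<longleftrightarrow> coprime t n" for t
  proof -
    have "(int i - int ((t + i) mod N)) mod int n = (int i - int ((t + i) mod N) mod int n) mod int n"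
      by (simp add: mod_diff_right_eq)
    also have "int ((t + i) mod N) mod int n = (int t + int i) mod int n"
      using N by (simp add: of_nat_mod mod_mod_cancel)
    also have "(int i - (int t + int i) mod int n) mod int n = (- int t) mod int n"
      by (simp add: mod_diff_right_eq)
    finally have "(int i - int ((t + i) mod N)) mod int n = (- int t) mod int n" .
    then have "coprime (int i - int ((t + i) mod N)) (int n) \<longleftrightarrow> coprime (- int t) (int n)"
      using n by (metis coprime_mod_left_iff of_nat_0_eq_iff less_irrefl)
    then show ?thesis by simp
  qed
  have "(\<Sum>k<N. of_bool (coprime (int i - int k) (int n)) * z ^ k) =
      (\<Sum>t<N. of_bool (coprime t n) * z ^ (t + i))"
    using sum.reindex_bij_betw[OF bij, symmetric,
        of "\<lambda>k. of_bool (coprime (int i - int k) (int n)) * z ^ k"]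
    by (simp only: cop zmod)
  also have "\<dots> = z ^ i * (\<Sum>t<N. of_bool (coprime t n) * z ^ t)"
    by (simp add: sum_distrib_left power_add mult_ac)
  also have "(\<Sum>t<N. of_bool (coprime t n) * z ^ t) = (\<Sum>t | t < N \<and> coprime t n. z ^ t)"
    by (rule sum.mono_neutral_cong_right) auto
  finally show ?thesis .
qed

section \<open>The eigenbasis of the adjacency matrix\<close>

lemma sum_times_bool:
  "finite A \<Longrightarrow> (\<Sum>v\<in>A \<times> UNIV. g v) = (\<Sum>i\<in>A. g (i, False)) + (\<Sum>i\<in>A. g (i, True))"
  for g :: "'a \<times> bool \<Rightarrow> 'b::comm_monoid_add"
  by (simp add: sum.cartesian_product' UNIV_bool sum.distrib add.commute)

lemma mset_set_times_bool:
  "finite A \<Longrightarrow> image_mset g (mset_set (A \<times> UNIV)) =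
    image_mset (\<lambda>i. g (i, False)) (mset_set A) + image_mset (\<lambda>i. g (i, True)) (mset_set A)"
  for g :: "'a \<times> bool \<Rightarrow> 'b"
proof -
  assume A: "finite A"
  have "A \<times> (UNIV :: bool set) = (\<lambda>i. (i, False)) ` A \<union> (\<lambda>i. (i, True)) ` A"
    by (auto simp: UNIV_bool)
  then have "mset_set (A \<times> (UNIV :: bool set)) =
      mset_set ((\<lambda>i. (i, False)) ` A) + mset_set ((\<lambda>i. (i, True)) ` A)"
    using A by (simp only:) (intro mset_set_Union; auto)
  then show ?thesis
    by (simp add: image_mset_mset_set[symmetric] inj_on_def image_mset.compositionality comp_def)
qed

text \<open>The \<open>4 * n\<close> eigenvectors are \<open>2 * n - 1\<close> kernel vectors,
  \<open>2 * n - 1\<close> nontrivial characters and one vector for each of \<open>l1\<close> and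
  \<open>l2\<close>. Only the quadratic equation and \<open>l1 \<noteq> l2\<close> enter, which
  keeps square roots out.\<close>

lemma proots_char_poly_dicyclic_adj:
  fixes l1 l2 w :: complex and n :: nat
  assumes n: "n \<ge> 2" and ps: "distinct ps" "set ps = {..<2 * n} \<times> UNIV"
    and w: "\<And>k. w ^ k = 1 \<longleftrightarrow> 2 * n dvd k"
    and l1: "l1 ^ 2 = 2 * of_nat (totient n) * l1 + 4 * of_nat n * of_nat (totient n)"
    and l2: "l2 ^ 2 = 2 * of_nat (totient n) * l2 + 4 * of_nat n * of_nat (totient n)"
    and neq: "l1 \<noteq> l2"
  shows "proots (char_poly (mat (length ps) (length ps)
      (\<lambda>(r, s). of_bool (dicyclic_adj n (ps ! r) (ps ! s))))) =
    {#l1, l2#} + replicate_mset (2 * n - 1) 0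
    + image_mset (\<lambda>l. \<Sum>t | t < 2 * n \<and> coprime t n. (w ^ l) ^ t) (mset_set {1..<2 * n})"
proof -
  note [simp del] = sum_of_bool_eq sum_mult_of_bool_eq sum_of_bool_mult_eq
  define N where "N = 2 * n"
  define F :: complex where "F = of_nat (totient n)"
  define C where "C z = (\<Sum>t | t < N \<and> coprime t n. z ^ t)" for z :: complex
  define u :: "nat \<Rightarrow> complex" where "u k = of_bool (coprime k n)" for k
  have N0: "N > 0" and N1: "1 < N" and n0: "n > 0" and nN: "n dvd N" using n by (auto simp: N_def)
  have F0: "F \<noteq> 0" using n0 by (simp add: F_def)
  have wN: "(w ^ l) ^ N = 1" for l using w[of "l * N"] by (simp add: N_def flip: power_mult)
  have C1: "C 1 = 2 * F"
    using sum_coprime_root_of_unity[OF n0 nN N0, of 1 1] n0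
    by (simp add: C_def F_def N_def moebius_mu_def)
  have circ: "(\<Sum>k<N. of_bool (coprime (int i - int k) (int n)) * z ^ k) = z ^ i * C z"
    if "z ^ N = 1" for z i
    unfolding C_def by (rule circulant_coprime_sum[OF n0 nN N0 that])
  have circ1: "(\<Sum>k<N. of_bool (coprime (int i - int k) (int n))) = 2 * F" for i
    using circ[of 1 i] by (simp add: C1)
  have sum_u: "(\<Sum>k<N. u k) = 2 * F"
    using C1 by (simp add: u_def C_def sum_of_bool_eq Int_def)
  have u_mult: "u i * u i = u i" for i by (simp add: u_def)
  \<comment> \<open>Index 1 is the pivot: the vector with entry 1 at \<open>i\<close> and
    \<open>- u i\<close> at 1 is orthogonal to \<open>u\<close> because
    \<open>u 1 = 1\<close>.\<close>
  have u1: "u 1 = 1" by (simp add: u_def)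
  \<comment> \<open>The quadratic divided by \<open>l\<close> is the eigenvalue equation, on the
    coset of \<open>y\<close>, of the vector equal to 1 there and to \<open>N / l * u\<close> on the
    rotations.\<close>
  have lam: "l \<noteq> 0 \<and> 2 * F * of_nat N / l + 2 * F = l"
    if "l ^ 2 = 2 * of_nat (totient n) * l + 4 * of_nat n * of_nat (totient n)" for l
  proof -
    have "l \<noteq> 0" using that n0 F0 by (auto simp: F_def)
    with that show ?thesis by (simp add: N_def F_def field_simps power2_eq_square)
  qed
  define ev :: "nat \<times> bool \<Rightarrow> complex" where
    "ev = (\<lambda>(i, b). if b then if i = 0 then l2 else C (w ^ i) else if i = 1 then l1 else 0)"
  \<comment> \<open>\<open>(i, True)\<close> with \<open>i \<noteq> 0\<close> indexes a character on the coset of \<open>y\<close>, \<open>(i, False)\<close> with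
    \<open>i \<noteq> 1\<close> a kernel vector on the rotations orthogonal to \<open>u\<close>. The two free indices
    \<open>(1, False)\<close> and \<open>(0, True)\<close> carry the eigenvectors of \<open>l1\<close> and \<open>l2\<close>.\<close>
  define f :: "nat \<times> bool \<Rightarrow> nat \<times> bool \<Rightarrow> complex" where
    "f = (\<lambda>(i, b) (k, c).
      if b then if i = 0 then if c then 1 else of_nat N / l2 * u k
                else if c then (w ^ i) ^ k else 0
      else if i = 1 then if c then 1 else of_nat N / l1 * u k
           else if c then 0 else of_bool (k = i) - u i * of_bool (k = 1))"
  have eig: "(\<Sum>v'\<in>{..<N} \<times> UNIV. of_bool (dicyclic_adj n v v') * f j v') = ev j * f j v"
    if j: "j \<in> {..<N} \<times> UNIV" and v: "v \<in> {..<N} \<times> UNIV" for j v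
  proof -
    obtain i b where j': "j = (i, b)" "i < N" using j by auto
    obtain k c where v': "v = (k, c)" "k < N" using v by auto
    have big: "(\<Sum>v'\<in>{..<N} \<times> UNIV. of_bool (dicyclic_adj n (k, c) v')
          * (case v' of (m, d) \<Rightarrow> if d then 1 else of_nat N / l * u m))
        = l * (if c then 1 else of_nat N / l * u k)"
      if "l ^ 2 = 2 * of_nat (totient n) * l + 4 * of_nat n * of_nat (totient n)" for l
    proof (cases c)
      case True
      have "(\<Sum>m<N. u m * (of_nat N / l * u m)) = (\<Sum>m<N. of_nat N / l * u m)"
        by (rule sum.cong) (simp_all add: u_def)
      also have "\<dots> = of_nat N / l * (2 * F)" by (simp only: sum_u flip: sum_distrib_left)
      finally have A: "(\<Sum>m<N. u m * (of_nat N / l * u m)) = of_nat N / l * (2 * F)" .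
      have "of_nat N / l * (2 * F) + 2 * F = l" using lam[OF that] by (simp add: mult_ac)
      then show ?thesis
        using True A circ1[of k]
        by (simp add: sum_times_bool u_def)
    next
      case False
      with lam[OF that] show ?thesis by (simp add: sum_times_bool u_def)
    qed
    show ?thesis
    proof (cases b)
      case True
      show ?thesis
      proof (cases "i = 0")
        case True
        with \<open>b\<close> big[OF l2] show ?thesis by (simp add: f_def ev_def j' v')
      next
        case False
        \<comment> \<open>A rotation sees the coset of \<open>y\<close> only through the sum of the
          entries there, which is 0 for a nontrivial character.\<close>
        have "(\<Sum>m<N. (w ^ i) ^ m) = 0"
          using sum_powers_root_of_unity[OF wN, of i] w[of i] False j'(2)
          by (auto simp: N_def dest: dvd_imp_le)
        then show ?thesis
          using \<open>b\<close> False circ[OF wN, of k i]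
          by (cases c) (simp_all add: f_def ev_def j' v' sum_times_bool flip: sum_distrib_left)
      qed
    next
      case False
      show ?thesis
      proof (cases "i = 1")
        case True
        with \<open>\<not> b\<close> big[OF l1] show ?thesis by (simp add: f_def ev_def j' v')
      next
        case False
        have "(\<Sum>m<N. u m * (of_bool (m = i) - u i * of_bool (m = 1))) =
            (\<Sum>m<N. u m * of_bool (m = i)) - (\<Sum>m<N. u m * (u i * of_bool (m = 1)))"
          by (simp add: right_diff_distrib sum_subtractf)
        also have "\<dots> = 0"
          using j'(2) N1 by (simp add: of_bool_def if_distrib sum.delta u1[unfolded One_nat_def] cong: if_cong)
        finally show ?thesis
          using \<open>\<not> b\<close> False by (cases c) (simp_all add: f_def ev_def j' v' sum_times_bool u_def)
      qed
    qed
  qed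
  have indep: "c j = 0"
    if c: "\<And>v. v \<in> {..<N} \<times> UNIV \<Longrightarrow> (\<Sum>j\<in>{..<N} \<times> UNIV. c j * f j v) = 0"
      and j: "j \<in> {..<N} \<times> UNIV" for c j
  proof -
    \<comment> \<open>On the coset of \<open>y\<close> the vectors for \<open>l1\<close> and
      \<open>l2\<close> both restrict to the trivial character, so their coefficients merge at index
      0. Fourier inversion then kills all of \<open>c'\<close>.\<close>
    define c' where "c' i = c (i, True) + of_bool (i = 0) * c (1, False)" for i
    have del: "(\<Sum>i<N. g i * of_bool (i = m)) = g m" if "m < N" for g :: "nat \<Rightarrow> complex" and m
      using that by (simp add: of_bool_def if_distrib sum.delta cong: if_cong)
    have "(\<Sum>i<N. c' i * (w ^ i) ^ k) = 0" if k: "k < N" for k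
    proof -
      have "(\<Sum>i<N. c (i, False) * f (i, False) (k, True)) = (\<Sum>i<N. c (i, False) * of_bool (i = 1))"
        by (rule sum.cong) (auto simp: f_def)
      also have "\<dots> = c (1, False)" using N1 by (rule del)
      also have "\<dots> = (\<Sum>i<N. (c (1, False) * (w ^ i) ^ k) * of_bool (i = 0))"
        using N0 by (simp add: del)
      finally have "0 = (\<Sum>i<N. (c (1, False) * (w ^ i) ^ k) * of_bool (i = 0))
          + (\<Sum>i<N. c (i, True) * f (i, True) (k, True))"
        using c[of "(k, True)"] k by (simp add: sum_times_bool)
      also have "\<dots> = (\<Sum>i<N. c' i * (w ^ i) ^ k)"
        unfolding sum.distrib[symmetric] by (rule sum.cong) (auto simp: f_def c'_def algebra_simps)
      finally show ?thesis by simp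
    qed
    then have c': "c' i = 0" if "i < N" for i
      using dft_eq_0_imp_eq_0[of w N c' i] w that by (simp add: N_def)
    have cT: "c (i, True) = 0" if "i < N" "i \<noteq> 0" for i using c'[OF that(1)] that(2) by (simp add: c'_def)
    have c01: "c (0, True) = - c (1, False)" using c'[OF N0] by (simp add: c'_def add_eq_0_iff)
    \<comment> \<open>The total coefficient of \<open>u\<close> that the vectors for
      \<open>l1\<close> and \<open>l2\<close> contribute on the rotations.\<close>
    define s where "s = of_nat N * (c (1, False) / l1 + c (0, True) / l2)"
    have row: "(\<Sum>i<N. if i = 1 then 0 else c (i, False) * (of_bool (k = i) - u i * of_bool (k = 1))) + s * u k = 0"
      if k: "k < N" for k
    proof -
      have "(\<Sum>i<N. c (i, False) * f (i, False) (k, False)) =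
          (\<Sum>i<N. (if i = 1 then 0 else c (i, False) * (of_bool (k = i) - u i * of_bool (k = 1)))
            + (c (i, False) * (of_nat N / l1 * u k)) * of_bool (i = 1))"
        by (rule sum.cong) (auto simp: f_def)
      also have "\<dots> = (\<Sum>i<N. if i = 1 then 0 else c (i, False) * (of_bool (k = i) - u i * of_bool (k = 1)))
          + c (1, False) * (of_nat N / l1 * u k)"
        unfolding sum.distrib del[OF N1] ..
      finally have A: "(\<Sum>i<N. c (i, False) * f (i, False) (k, False)) = \<dots>" .
      have "(\<Sum>i<N. c (i, True) * f (i, True) (k, False)) =
          (\<Sum>i<N. (c (i, True) * (of_nat N / l2 * u k)) * of_bool (i = 0))"
        by (rule sum.cong) (auto simp: f_def)
      also have "\<dots> = c (0, True) * (of_nat N / l2 * u k)" by (rule del[OF N0])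
      finally have B: "(\<Sum>i<N. c (i, True) * f (i, True) (k, False)) = \<dots>" .
      show ?thesis
        using c[of "(k, False)"] k by (simp add: sum_times_bool A B s_def algebra_simps)
    qed
    have cF: "c (k, False) = - s * u k" if "k < N" "k \<noteq> 1" for k
    proof -
      have "(\<Sum>i<N. if i = 1 then 0 else c (i, False) * (of_bool (k = i) - u i * of_bool (k = 1))) =
          (\<Sum>i<N. c (i, False) * of_bool (i = k))"
        by (rule sum.cong) (use that in auto)
      also have "\<dots> = c (k, False)" using that(1) by (rule del)
      finally show ?thesis using row[OF that(1)] by (simp add: add_eq_0_iff)
    qed
    \<comment> \<open>The pivot row: inserting \<open>cF\<close> turns its sum into
      \<open>s * (2 * F) - s\<close>, and the remaining term \<open>s * u 1\<close> cancels the
      \<open>- s\<close>.\<close>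
    have "(\<Sum>i<N. if i = 1 then 0 else c (i, False) * (of_bool (1 = i) - u i * of_bool (1 = (1::nat)))) =
        (\<Sum>i<N. s * u i - (s * u i) * of_bool (i = 1))"
      by (rule sum.cong) (auto simp: cF mult.assoc u_mult)
    also have "\<dots> = s * (2 * F) - s"
      unfolding sum_subtractf del[OF N1] u1 by (simp add: sum_u flip: sum_distrib_left)
    finally have "s * (2 * F) = 0" using row[OF N1] u1 by simp
    then have s0: "s = 0" using F0 by simp
    \<comment> \<open>Here the distinctness of \<open>l1\<close> and \<open>l2\<close> separates the
      two special vectors.\<close>
    then have "c (1, False) / l1 = c (1, False) / l2" using N0 by (simp add: s_def c01)
    then have "c (1, False) = 0" using neq lam[OF l1] lam[OF l2] by (simp add: field_simps)
    moreover obtain i b where "j = (i, b)" "i < N" using j by auto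
    ultimately show ?thesis
      using cT[of i] cF[of i] c01 s0 by (cases b; cases "i = 0"; cases "i = 1") simp_all
  qed
  have "proots (char_poly (mat (length ps) (length ps)
      (\<lambda>(r, s). of_bool (dicyclic_adj n (ps ! r) (ps ! s))))) =
    image_mset ev (mset_set ({..<N} \<times> UNIV))"
  proof (rule proots_char_poly_eigenbasis[where f = f])
    show "card ({..<N} \<times> (UNIV :: bool set)) = length ps"
      using distinct_card[OF ps(1)] ps(2) by (simp add: N_def)
  qed (use ps eig indep in \<open>auto simp: N_def\<close>)
  also have "\<dots> = image_mset (\<lambda>i. if i = 1 then l1 else 0) (mset_set {..<N})
      + image_mset (\<lambda>i. if i = 0 then l2 else C (w ^ i)) (mset_set {..<N})"
    by (simp add: mset_set_times_bool ev_def)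
  also have "image_mset (\<lambda>i. if i = 1 then l1 else 0) (mset_set {..<N}) =
      {#l1#} + image_mset (\<lambda>i. if i = 1 then l1 else 0) (mset_set ({..<N} - {1}))"
    using N1 by (subst mset_set.remove[of _ 1]) simp_all
  also have "image_mset (\<lambda>i. if i = 1 then l1 else 0) (mset_set ({..<N} - {1})) =
      image_mset (\<lambda>i. 0) (mset_set ({..<N} - {1}))"
    by (rule image_mset_cong) auto
  also have "\<dots> = replicate_mset (N - 1) 0"
    using N1 by (simp add: image_mset_const_eq)
  also have "{..<N} = insert 0 {1..<N}" using N0 by auto
  also have "image_mset (\<lambda>i. if i = 0 then l2 else C (w ^ i)) (mset_set (insert 0 {1..<N})) =
      {#l2#} + image_mset (\<lambda>i. if i = 0 then l2 else C (w ^ i)) (mset_set {1..<N})"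
    by simp
  also have "image_mset (\<lambda>i. if i = 0 then l2 else C (w ^ i)) (mset_set {1..<N}) =
      image_mset (\<lambda>i. C (w ^ i)) (mset_set {1..<N})"
    by (rule image_mset_cong) auto
  finally show ?thesis by (simp add: N_def C_def)
qed

section \<open>Multiplicities\<close>

text \<open>Induction on \<open>D\<close>, splitting off one fibre of the key at a time. The key
  will be the order of a root of unity, on which alone the circulant eigenvalue depends.\<close>

lemma image_mset_by_key:
  assumes "finite A" "finite D" and "\<And>x. x \<in> A \<Longrightarrow> \<kappa> x \<notin> D \<Longrightarrow> h (\<kappa> x) = z"
  shows "image_mset (\<lambda>x. h (\<kappa> x)) (mset_set A) =
    replicate_mset (card {x\<in>A. \<kappa> x \<notin> D}) z + (\<Sum>e\<in>D. replicate_mset (card {x\<in>A. \<kappa> x = e}) (h e))"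
  using assms(2,1,3)
proof (induction D arbitrary: A rule: finite_induct)
  case empty
  then have "image_mset (\<lambda>x. h (\<kappa> x)) (mset_set A) = image_mset (\<lambda>x. z) (mset_set A)"
    by (intro image_mset_cong) auto
  then show ?case by (simp add: image_mset_const_eq)
next
  case (insert d D)
  define B where "B = {x\<in>A. \<kappa> x \<noteq> d}"
  define E where "E = {x\<in>A. \<kappa> x = d}"
  have fin: "finite B" "finite E" using insert.prems(1) by (auto simp: B_def E_def)
  have "A = B \<union> E" by (auto simp: B_def E_def)
  then have "mset_set A = mset_set B + mset_set E"
    using fin by (simp only:) (rule mset_set_Union, auto simp: B_def E_def)
  moreover have "image_mset (\<lambda>x. h (\<kappa> x)) (mset_set E) = image_mset (\<lambda>x. h d) (mset_set E)"
    by (rule image_mset_cong) (use fin in \<open>auto simp: E_def\<close>)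
  moreover have "image_mset (\<lambda>x. h (\<kappa> x)) (mset_set B) = replicate_mset (card {x\<in>B. \<kappa> x \<notin> D}) z
      + (\<Sum>e\<in>D. replicate_mset (card {x\<in>B. \<kappa> x = e}) (h e))"
    using fin insert.prems(2) by (intro insert.IH) (auto simp: B_def)
  moreover have "{x\<in>B. \<kappa> x \<notin> D} = {x\<in>A. \<kappa> x \<notin> insert d D}" by (auto simp: B_def)
  moreover have "(\<Sum>e\<in>D. replicate_mset (card {x\<in>B. \<kappa> x = e}) (h e)) =
      (\<Sum>e\<in>D. replicate_mset (card {x\<in>A. \<kappa> x = e}) (h e))"
    using insert.hyps
    by (intro sum.cong HOL.refl arg_cong2[of _ _ _ _ replicate_mset] arg_cong[of _ _ card])
      (auto simp: B_def)
  ultimately show ?case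
    using insert.hyps by (simp add: image_mset_const_eq E_def ac_simps)
qed

text \<open>\<open>N div gcd l N\<close> is the additive order of \<open>l\<close> modulo
  \<open>N\<close>, and a cyclic group has \<open>totient e\<close> elements of order
  \<open>e\<close>. The omitted class of 0 is the only one of order 1.\<close>

lemma card_additive_order_eq:
  fixes e N :: nat
  assumes N: "N > 0" and e: "e dvd N" "e \<noteq> 1"
  shows "card {l\<in>{1..<N}. N div gcd l N = e} = totient e"
proof -
  have dd: "N div (N div a) = a" if "a dvd N" for a using N that by auto
  have "N div gcd l N = e \<longleftrightarrow> gcd l N = N div e" for l
    using dd[OF e(1)] dd[OF gcd_dvd2[of l N]] by metis
  moreover have "N div e \<noteq> N" using dd[OF e(1)] e(2) N by auto
  ultimately have "{l\<in>{1..<N}. N div gcd l N = e} = {l\<in>{0<..N}. gcd l N = N div e}"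
    by (auto simp: le_less)
  moreover have "N div e dvd N" "N div (N div e) = e" using e(1) dd by auto
  ultimately show ?thesis using card_gcd_eq_totient[OF N, of "N div e"] by simp
qed

lemma root_of_unity_power_order:
  fixes w :: complex
  assumes w: "\<And>k. w ^ k = 1 \<longleftrightarrow> N dvd k" and N: "N > 0"
  shows "(w ^ l) ^ k = 1 \<longleftrightarrow> N div gcd l N dvd k"
proof -
  have "(w ^ l) ^ k = 1 \<longleftrightarrow> N dvd l * k" using w[of "l * k"] by (simp add: power_mult)
  also have "\<dots> \<longleftrightarrow> gcd l N * (N div gcd l N) dvd gcd l N * (l div gcd l N * k)"
    by (simp flip: mult.assoc)
  also have "\<dots> \<longleftrightarrow> N div gcd l N dvd l div gcd l N * k"
    using N by (subst nat_mult_dvd_cancel_disj) simp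
  also have "\<dots> \<longleftrightarrow> N div gcd l N dvd k"
    using div_gcd_coprime[of l N] N by (intro coprime_dvd_mult_right_iff) (auto simp: coprime_commute)
  finally show ?thesis .
qed

text \<open>The root \<open>w ^ l\<close> has order \<open>\<kappa> l\<close>, and its Ramanujan sum
  is nonzero only if this order divides the radical. The factor 2 is the number of periods of length
  \<open>n\<close> in \<open>2 * n\<close>.\<close>

lemma image_mset_circulant_eigenvalues:
  fixes w :: complex
  assumes n: "n \<ge> 2" and w: "\<And>k. w ^ k = 1 \<longleftrightarrow> 2 * n dvd k"
  shows "image_mset (\<lambda>l. \<Sum>t | t < 2 * n \<and> coprime t n. (w ^ l) ^ t) (mset_set {1..<2 * n}) =
    replicate_mset (2 * n - \<Prod>(prime_factors n)) 0
    + (\<Sum>e\<in>{e. e dvd \<Prod>(prime_factors n)} - {1}. replicate_mset (totient e)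
         (2 * of_int (moebius_mu e) * (of_nat (totient n) / of_nat (totient e))))"
    (is "image_mset ?C _ = _ + (\<Sum>e\<in>?D. ?r e)")
proof -
  define h :: "nat \<Rightarrow> complex" where "h e = (if e dvd \<Prod>(prime_factors n)
    then 2 * of_int (moebius_mu e) * (of_nat (totient n) / of_nat (totient e)) else 0)" for e
  define \<kappa> where "\<kappa> l = 2 * n div gcd l (2 * n)" for l
  have N: "2 * n > 0" and n0: "n > 0" using n by auto
  have P0: "\<Prod>(prime_factors n) > 0" by (intro prod_pos prime_gt_0_nat in_prime_factors_imp_prime)
  have P2: "\<Prod>(prime_factors n) dvd 2 * n" using prod_prime_factors_dvd[of n] by simp
  have fin: "finite ?D" using P0 by auto
  have C: "?C l = h (\<kappa> l)" for l
  proof -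
    have "\<kappa> l dvd 2 * n" unfolding \<kappa>_def by (metis dvd_div_mult_self dvd_triv_left gcd_dvd2)
    then show ?thesis
      using sum_coprime_root_of_unity[OF n0 _ N root_of_unity_power_order[OF w N, of l]] n0
      by (simp add: h_def \<kappa>_def)
  qed
  have k1: "\<kappa> l \<noteq> 1" if "l \<in> {1..<2 * n}" for l
  proof
    assume "\<kappa> l = 1"
    then have "gcd l (2 * n) = 2 * n"
      unfolding \<kappa>_def by (metis dvd_mult_div_cancel gcd_dvd2 mult.right_neutral)
    then have "2 * n dvd l" by (metis gcd_dvd1)
    with that show False by (auto dest: dvd_imp_le)
  qed
  have "image_mset ?C (mset_set {1..<2 * n}) =
      replicate_mset (card {l\<in>{1..<2 * n}. \<kappa> l \<notin> ?D}) 0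
      + (\<Sum>e\<in>?D. replicate_mset (card {l\<in>{1..<2 * n}. \<kappa> l = e}) (h e))"
    unfolding C by (rule image_mset_by_key) (use fin k1 in \<open>auto simp: h_def\<close>)
  also have "(\<Sum>e\<in>?D. replicate_mset (card {l\<in>{1..<2 * n}. \<kappa> l = e}) (h e)) = (\<Sum>e\<in>?D. ?r e)"
    unfolding \<kappa>_def using P2
    by (intro sum.cong HOL.refl arg_cong2[of _ _ _ _ replicate_mset] card_additive_order_eq[OF N])
      (auto simp: h_def intro: dvd_trans)
  finally have eq: "image_mset ?C (mset_set {1..<2 * n}) =
      replicate_mset (card {l\<in>{1..<2 * n}. \<kappa> l \<notin> ?D}) 0 + (\<Sum>e\<in>?D. ?r e)" .
  have size_sum: "size (\<Sum>e\<in>D. f e) = (\<Sum>e\<in>D. size (f e))" for D and f :: "nat \<Rightarrow> complex multiset"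
    by (induction D rule: infinite_finite_induct) auto
  \<comment> \<open>The multiplicity of 0 comes from comparing sizes: the totients of the divisors
    of the radical sum to the radical, and the divisor 1 is left out.\<close>
  have "1 + (\<Sum>e\<in>?D. totient e) = \<Prod>(prime_factors n)"
    using sum.remove[of "{e. e dvd \<Prod>(prime_factors n)}" 1 totient]
      totient_divisor_sum[of "\<Prod>(prime_factors n)"] P0 by simp
  moreover have "2 * n - 1 = card {l\<in>{1..<2 * n}. \<kappa> l \<notin> ?D} + (\<Sum>e\<in>?D. totient e)"
    using arg_cong[OF eq, of size] by (simp add: size_sum)
  ultimately have "card {l\<in>{1..<2 * n}. \<kappa> l \<notin> ?D} = 2 * n - \<Prod>(prime_factors n)" by linarith
  with eq show ?thesis by simp
qed

section \<open>Assembly of the spectrum\<close>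

theorem theorem4p10:
  fixes n n0 k :: nat and d :: "nat \<Rightarrow> nat" and vs :: "dicyclic_gen word set list"
    and l1 l2 :: real
  assumes "n \<ge> 2"
    and "n0 = \<Prod>(prime_factors n)"
    and "k = card (prime_factors n)"
    and "strict_mono_on {1..2 ^ k} d"
    and "d ` {1..2 ^ k} = {e. e dvd n0}"
    and "distinct vs"
    and "set vs = pverts (generating_graph (dicyclic_group n))"
    and "l1 = real (totient n) + sqrt (real (totient n) ^ 2 + 4 * real n * real (totient n))"
    and "l2 = real (totient n) - sqrt (real (totient n) ^ 2 + 4 * real n * real (totient n))"
  shows "spectrum_mset (adjacency_matrix (generating_graph (dicyclic_group n)) vs) =
    replicate_mset (4 * n - (n0 + 1)) 0
    + (\<Sum>i = 2..2 ^ k. replicate_mset (totient (d i))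
         (2 * of_int (moebius_mu (d i)) * (of_nat (totient n) / of_nat (totient (d i)))))
    + {# complex_of_real l1, complex_of_real l2 #}"
proof -
  have n: "n > 0" using assms(1) by simp
  let ?V = "{..<2 * n} \<times> (UNIV :: bool set)"
  let ?g = "\<lambda>e. replicate_mset (totient e)
    (2 * of_int (moebius_mu e) * (of_nat (totient n) / of_nat (totient e))) :: complex multiset"
  define \<psi> where "\<psi> = (\<lambda>(i, b). dicyclic_elem n (int i) b)"
  have bij: "bij_betw \<psi> ?V (set vs)"
    using bij_betw_dicyclic_elem[OF n] assms(7) by (simp add: \<psi>_def generating_graph_def)
  \<comment> \<open>The coordinates listed in the order of \<open>vs\<close>, so that the two
    matrices agree entry by entry for any enumeration of the vertices.\<close>
  define ps where "ps = map (inv_into ?V \<psi>) vs"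
  note bij' = bij_betw_inv_into[OF bij]
  have ps: "distinct ps" "set ps = ?V"
    using bij' assms(6) by (auto simp: ps_def distinct_map bij_betw_def)
  have len: "length ps = length vs" by (simp add: ps_def)
  have vs: "vs ! r = \<psi> (ps ! r)" if "r < length vs" for r
    using that bij_betw_inv_into_right[OF bij] by (simp add: ps_def)
  have "adjacency_matrix (generating_graph (dicyclic_group n)) vs =
      mat (length ps) (length ps) (\<lambda>(r, s). of_bool (dicyclic_adj n (ps ! r) (ps ! s)))"
  proof (rule eq_matI)
    fix r s
    assume "r < dim_row (mat (length ps) (length ps) (\<lambda>(r, s). of_bool (dicyclic_adj n (ps ! r) (ps ! s)) :: complex))"
      "s < dim_col (mat (length ps) (length ps) (\<lambda>(r, s). of_bool (dicyclic_adj n (ps ! r) (ps ! s)) :: complex))"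
    then have rs: "r < length vs" "s < length vs" by (simp_all add: len)
    obtain i b j c where "ps ! r = (i, b)" "ps ! s = (j, c)" by (metis surj_pair)
    then show "adjacency_matrix (generating_graph (dicyclic_group n)) vs $$ (r, s) =
        mat (length ps) (length ps) (\<lambda>(r, s). of_bool (dicyclic_adj n (ps ! r) (ps ! s))) $$ (r, s)"
      using rs parcs_generating_graph_dicyclic[OF assms(1), of i b j c]
      by (simp add: adjacency_matrix_def len vs \<psi>_def of_bool_def del: dicyclic_adj.simps)
  qed (simp_all add: adjacency_matrix_def len)
  moreover obtain w :: complex where w: "\<And>k. w ^ k = 1 \<longleftrightarrow> 2 * n dvd k"
    using primitive_root_of_unity_exists[of "2 * n"] n by auto
  have rad: "real (totient n) ^ 2 + 4 * real n * real (totient n) > 0"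
    using n by (intro add_pos_pos) auto
  have "l1 ^ 2 = 2 * real (totient n) * l1 + 4 * real n * real (totient n)"
    "l2 ^ 2 = 2 * real (totient n) * l2 + 4 * real n * real (totient n)"
    using rad by (simp_all add: assms(8,9) power2_sum power2_diff algebra_simps)
      (simp_all add: power2_eq_square)
  from this[THEN arg_cong[of _ _ complex_of_real]]
  have quad: "complex_of_real l1 ^ 2 = 2 * of_nat (totient n) * of_real l1 + 4 * of_nat n * of_nat (totient n)"
    "complex_of_real l2 ^ 2 = 2 * of_nat (totient n) * of_real l2 + 4 * of_nat n * of_nat (totient n)"
    by simp_all
  have "complex_of_real l1 \<noteq> of_real l2" using rad by (simp add: assms(8,9))
  ultimately have spec: "spectrum_mset (adjacency_matrix (generating_graph (dicyclic_group n)) vs) =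
      {#complex_of_real l1, complex_of_real l2#} + replicate_mset (2 * n - 1) 0
      + (replicate_mset (2 * n - n0) 0 + (\<Sum>e\<in>{e. e dvd n0} - {1}. replicate_mset (totient e)
         (2 * of_int (moebius_mu e) * (of_nat (totient n) / of_nat (totient e)))))"
    using proots_char_poly_dicyclic_adj[OF assms(1) ps w quad]
      image_mset_circulant_eigenvalues[OF assms(1) w]
    by (simp add: spectrum_mset_def assms(2))
  have n0n: "n0 dvd n" unfolding assms(2) by (rule prod_prime_factors_dvd)
  then have n0: "n0 \<le> n" "n0 > 0" using n by (auto intro: dvd_imp_le Nat.gr0I)
  have inj: "inj_on d {1..2 ^ k}" using assms(4) by (rule strict_mono_on_imp_inj_on)
  \<comment> \<open>The divisor 1 is some \<open>d j\<close>, and monotonicity puts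
    \<open>d 1\<close> below it. The sum from 2 on thus runs over the divisors other than 1.\<close>
  have "d 1 = 1"
  proof -
    obtain j where j: "j \<in> {1..2 ^ k}" "d j = 1" using assms(5) by (metis (mono_tags) imageE mem_Collect_eq one_dvd)
    have "d 1 dvd n0" using assms(5) by auto
    then have "d 1 \<noteq> 0" using n0 by auto
    moreover have "d 1 \<le> d j" using strict_mono_on_leD[OF assms(4), of 1 j] j(1) by simp
    ultimately show ?thesis using j(2) by simp
  qed
  moreover have "{1..2 ^ k} = insert 1 {2..2 ^ k :: nat}" by auto
  ultimately have "d ` {2..2 ^ k} = {e. e dvd n0} - {1}" "inj_on d {2..2 ^ k}"
    using inj assms(5) by (auto simp: inj_on_def)
  then have sum_d: "(\<Sum>i = 2..2 ^ k. g (d i)) = (\<Sum>e\<in>{e. e dvd n0} - {1}. g e)"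
    for g :: "nat \<Rightarrow> complex multiset"
    by (metis sum.reindex_cong)
  \<comment> \<open>Zeros from the kernel vectors on the rotations and from the characters;
    \<open>n0 \<le> n\<close> rules out truncated subtraction.\<close>
  have "4 * n - (n0 + 1) = (2 * n - 1) + (2 * n - n0)" using n0 n by linarith
  then have "replicate_mset (4 * n - (n0 + 1)) (0 :: complex) =
      replicate_mset (2 * n - 1) 0 + replicate_mset (2 * n - n0) 0"
    by (auto intro!: multiset_eqI)
  then show ?thesis
    unfolding spec by (simp only: sum_d[of ?g]) (simp add: ac_simps)
qed

end
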